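(* Let $P_0$ and $H$ be probability distributions on $\mathbb{R}^d$ with Lebesgue densities $p_0$ and $h$, with $H \neq P_0$ and $P_0(\{y : h(y) > 0\}) = 1$. Let $\pi_\alpha$ be a probability density on $(0,\infty)$, and let $Y_1, Y_2, \ldots$ be i.i.d. with distribution $P_0$. Let $\rho$ be a metric on the set $\mathcal{P}(\mathbb{R}^d)$ of probability distributions on $\mathbb{R}^d$ that metrizes convergence in distribution. Let $\Pr(\cdot \mid Y_{1:N})$ denote the posterior law of $P$ given $Y_{1:N} = (Y_1,\ldots,Y_N)$ under the hierarchical model $$\alpha \sim \pi_\alpha, \qquad [P \mid \alpha] \sim \operatorname{DP}(\alpha, H), \qquad [Y_1, Y_2, \ldots \mid P] \overset{\mathrm{iid}}{\sim} P$$ (in the explicit version given in the context). For $t \in [0,\infty)$ put $$Q_t = \frac{t}{1+t}\, H + \frac{1}{1+t}\, P_0,$$ and put $Q_\infty = H$. Then for every $\epsilon > 0$, $$\Pr\{\rho(P, Q_t) > \epsilon \mid Y_{1:N}\} \longrightarrow 0 \quad \text{as } N \to \infty, \text{ with } P_0\text{-probability } 1,$$ where - $t = 0$ if $\pi_\alpha$ has light tails (L); - $t = t_c$ if $\pi_\alpha$ has exponential tails (E) with constant $c \in (0,\infty)$, where $t_c$ is the unique solution in $(0,\infty)$ of $\frac{1}{t} - \log\left(1 + \frac{1}{t}\right) = c$; - $t = \infty$ if $\pi_\alpha$ has heavy tails (H).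
   Context: **Dirichlet process.** For $\alpha > 0$ and a probability distribution $H$ on $\mathbb{R}^d$, $P \sim \operatorname{DP}(\alpha, H)$ means that $P$ is a random probability distribution on $\mathbb{R}^d$ such that, for every measurable partition $\{A_1,\ldots,A_M\}$ of $\mathbb{R}^d$, $(P(A_1),\ldots,P(A_M)) \sim \operatorname{Dirichlet}(\alpha H(A_1),\ldots,\alpha H(A_M))$. **Posterior.** Let $\mathbb{P}_N = \frac{1}{N}\sum_{i=1}^N \delta_{Y_i}$. The posterior law of $P$ given $Y_{1:N}$ is the mixture $$\Pr(P \in \cdot \mid Y_{1:N}) = \int_0^\infty \operatorname{DP}\left(\cdot \;\middle|\; \alpha + N,\ \frac{\alpha}{\alpha+N} H + \frac{N}{\alpha+N}\mathbb{P}_N\right) \pi(\alpha \mid Y_{1:N})\, d\alpha,$$ where $\operatorname{DP}(\cdot \mid a, G)$ is the law of a $\operatorname{DP}(a,G)$ random distribution and the marginal posterior density of $\alpha$ is $$\pi(\alpha \mid Y_{1:N}) \propto \frac{\pi_\alpha(\alpha)\, \alpha^{k}\, \Gamma(\alpha)}{\Gamma(\alpha + N)}, \qquad \alpha > 0,$$ with $k = K_N$ the number of distinct values among $Y_1,\ldots,Y_N$ (so $K_N = N$ almost surely under $P_0$). **Tail regimes.** Let $V(\alpha) = -\log \pi_\alpha(\alpha)$. - Light tail (L): either $\pi_\alpha$ has bounded support, or $\pi_\alpha$ is log-concave for all sufficiently large $\alpha$ and $V(\alpha)/\alpha \to \infty$ as $\alpha \to \infty$. - Exponential tail (E): there exists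 $c \in (0,\infty)$ such that $V(\alpha)/\alpha \to c$ as $\alpha \to \infty$. - Heavy tail (H): $V(\alpha)/\alpha \to 0$ as $\alpha \to \infty$. *)

theory Defs
  imports "HOL-Probability.Probability"
begin

text \<open>
  The gamma distribution with shape \<open>a\<close> and scale 1, extended to \<open>a = 0\<close> by the point mass at 0
  (the library's \<open>erlang_density\<close> only covers integer shapes).
\<close>

definition gamma_dist :: "real \<Rightarrow> real measure" where
  "gamma_dist a =
     (if a > 0
      then density lborel (\<lambda>x. ennreal (indicator {0<..} x * (x powr (a - 1) * exp (- x) / Gamma a)))
      else return borel 0)"

text \<open>
  The Dirichlet distribution with parameters \<open>a i \<ge> 0\<close>, not all zero, as the law of a normalised
  vector of independent gamma variables.  This is the definition of Ferguson (1973); coordinates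
  with parameter zero vanish almost surely, which is what is needed for partitions that contain
  null sets of the base distribution.
\<close>

definition dirichlet_dist :: "'i set \<Rightarrow> ('i \<Rightarrow> real) \<Rightarrow> ('i \<Rightarrow> real) measure" where
  "dirichlet_dist I a =
     distr (\<Pi>\<^sub>M i\<in>I. gamma_dist (a i)) (\<Pi>\<^sub>M i\<in>I. borel) (\<lambda>x. \<lambda>i\<in>I. x i / (\<Sum>j\<in>I. x j))"

definition measurable_partition :: "'a::topological_space set list \<Rightarrow> bool" where
  "measurable_partition As \<longleftrightarrow>
     set As \<subseteq> sets borel \<and> (\<Union>(set As)) = UNIV \<and> disjoint_family_on (\<lambda>i. As ! i) {..<length As}"

text \<open>
  \<open>prob_algebra borel\<close> is the space of probability measures on the Borel sets, with the
  \<open>\<sigma>\<close>-algebra generated by the evaluations \<open>P \<mapsto> P(A)\<close>.  A random probability distribution is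
  represented by its law on this space.
\<close>

definition is_dirichlet_process ::
    "real \<Rightarrow> 'a::topological_space measure \<Rightarrow> 'a measure measure \<Rightarrow> bool" where
  "is_dirichlet_process a G D \<longleftrightarrow>
     prob_space D \<and> sets D = sets (prob_algebra borel) \<and>
     (\<forall>As. measurable_partition As \<longrightarrow>
        distr D (\<Pi>\<^sub>M i\<in>{..<length As}. borel) (\<lambda>P. \<lambda>i\<in>{..<length As}. measure P (As ! i))
          = dirichlet_dist {..<length As} (\<lambda>i. a * measure G (As ! i)))"

text \<open>
  For \<open>a > 0\<close> and a probability measure \<open>G\<close> on a Euclidean space, a law with this property exists
  and is unique (Ferguson 1973), so \<open>dirichlet_process a G\<close> is that law.  As for \<open>RN_deriv\<close>, the
  other branch only makes the function total.
\<close>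

definition dirichlet_process ::
    "real \<Rightarrow> 'a::topological_space measure \<Rightarrow> 'a measure measure" where
  "dirichlet_process a G =
     (if \<exists>D. is_dirichlet_process a G D
      then SOME D. is_dirichlet_process a G D
      else null_measure (prob_algebra borel))"

definition mixture :: "real \<Rightarrow> 'a measure \<Rightarrow> 'a measure \<Rightarrow> 'a measure" where
  "mixture u P Q =
     measure_of (space P) (sets P) (\<lambda>A. ennreal u * emeasure P A + ennreal (1 - u) * emeasure Q A)"

lemma sets_mixture [simp]: "sets (mixture u P Q) = sets P"
  by (simp add: mixture_def)

lemma emeasure_mixture:
  assumes "sets Q = sets P" "A \<in> sets P"
  shows "emeasure (mixture u P Q) A = ennreal u * emeasure P A + ennreal (1 - u) * emeasure Q A"
  unfolding mixture_def
proof (rule emeasure_measure_of_sigma)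
  show "sigma_algebra (space P) (sets P)"
    by (rule sets.sigma_algebra_axioms)
  show "positive (sets P) (\<lambda>A. ennreal u * emeasure P A + ennreal (1 - u) * emeasure Q A)"
    by (simp add: positive_def)
  show "countably_additive (sets P)
          (\<lambda>A. ennreal u * emeasure P A + ennreal (1 - u) * emeasure Q A)"
  proof (rule countably_additiveI)
    fix F :: "nat \<Rightarrow> 'a set"
    assume F: "range F \<subseteq> sets P" "disjoint_family F"
    have "(\<Sum>i. ennreal u * emeasure P (F i) + ennreal (1 - u) * emeasure Q (F i)) =
          ennreal u * (\<Sum>i. emeasure P (F i)) + ennreal (1 - u) * (\<Sum>i. emeasure Q (F i))"
      by (simp add: suminf_add[symmetric] ennreal_suminf_cmult)
    then show "(\<Sum>i. ennreal u * emeasure P (F i) + ennreal (1 - u) * emeasure Q (F i)) =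
        ennreal u * emeasure P (\<Union> (range F)) + ennreal (1 - u) * emeasure Q (\<Union> (range F))"
      using F assms(1) by (simp add: suminf_emeasure)
  qed
qed (use assms in auto)

text \<open>The observations \<open>Y\<^sub>1, \<dots>, Y\<^sub>N\<close> are \<open>y 0, \<dots>, y (N - 1)\<close>.\<close>

definition empirical_measure :: "nat \<Rightarrow> (nat \<Rightarrow> 'a::topological_space) \<Rightarrow> 'a measure" where
  "empirical_measure N y = distr (uniform_count_measure {..<N}) borel y"

text \<open>
  The prior density of the concentration parameter is a function on the reals of which only the
  values on \<open>(0, \<infinity>)\<close> are used.
\<close>

definition alpha_posterior_kernel :: "(real \<Rightarrow> real) \<Rightarrow> nat \<Rightarrow> (nat \<Rightarrow> 'a) \<Rightarrow> real \<Rightarrow> ennreal" where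
  "alpha_posterior_kernel pa N y \<alpha> =
     ennreal (pa \<alpha> * \<alpha> ^ card (y ` {..<N}) * Gamma \<alpha> / Gamma (\<alpha> + real N))"

definition alpha_posterior_density :: "(real \<Rightarrow> real) \<Rightarrow> nat \<Rightarrow> (nat \<Rightarrow> 'a) \<Rightarrow> real \<Rightarrow> ennreal" where
  "alpha_posterior_density pa N y \<alpha> =
     alpha_posterior_kernel pa N y \<alpha> / (\<integral>\<^sup>+\<beta>\<in>{0<..}. alpha_posterior_kernel pa N y \<beta> \<partial>lborel)"

definition posterior_prob ::
    "(real \<Rightarrow> real) \<Rightarrow> 'a::topological_space measure \<Rightarrow> nat \<Rightarrow> (nat \<Rightarrow> 'a) \<Rightarrow> 'a measure set \<Rightarrow> ennreal"
  where
  "posterior_prob pa H N y B =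
     (\<integral>\<^sup>+\<alpha>\<in>{0<..}.
        emeasure (dirichlet_process (\<alpha> + real N)
                    (mixture (\<alpha> / (\<alpha> + real N)) H (empirical_measure N y))) B
        * alpha_posterior_density pa N y \<alpha> \<partial>lborel)"

text \<open>
  \<open>V = - log pa\<close>, with value \<open>\<infinity>\<close> where the density vanishes; since \<open>ln 0 = 0\<close>, the real-valued
  expression would wrongly make a compactly supported density heavy-tailed.
\<close>

definition neg_log_density :: "(real \<Rightarrow> real) \<Rightarrow> real \<Rightarrow> ereal" where
  "neg_log_density pa \<alpha> = (if pa \<alpha> > 0 then ereal (- ln (pa \<alpha>)) else \<infinity>)"

text \<open>Log-concavity in multiplicative form, which allows the value 0.\<close>

definition log_concave_on :: "real set \<Rightarrow> (real \<Rightarrow> real) \<Rightarrow> bool" where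
  "log_concave_on S f \<longleftrightarrow>
     (\<forall>x\<in>S. \<forall>y\<in>S. \<forall>u\<in>{0<..<1}. f x powr (1 - u) * f y powr u \<le> f ((1 - u) * x + u * y))"

definition light_tail :: "(real \<Rightarrow> real) \<Rightarrow> bool" where
  "light_tail pa \<longleftrightarrow>
     bounded {\<alpha>. \<alpha> > 0 \<and> pa \<alpha> \<noteq> 0} \<or>
     (\<exists>B>0. log_concave_on {B<..} pa) \<and>
       ((\<lambda>\<alpha>. neg_log_density pa \<alpha> / ereal \<alpha>) \<longlongrightarrow> \<infinity>) at_top"

definition exponential_tail :: "(real \<Rightarrow> real) \<Rightarrow> real \<Rightarrow> bool" where
  "exponential_tail pa c \<longleftrightarrow>
     c > 0 \<and> ((\<lambda>\<alpha>. neg_log_density pa \<alpha> / ereal \<alpha>) \<longlongrightarrow> ereal c) at_top"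

definition heavy_tail :: "(real \<Rightarrow> real) \<Rightarrow> bool" where
  "heavy_tail pa \<longleftrightarrow> ((\<lambda>\<alpha>. neg_log_density pa \<alpha> / ereal \<alpha>) \<longlongrightarrow> 0) at_top"

text \<open>The library's \<open>weak_conv_m\<close> is restricted to measures on the real line.\<close>

definition converges_in_distribution ::
    "(nat \<Rightarrow> 'a::topological_space measure) \<Rightarrow> 'a measure \<Rightarrow> bool" where
  "converges_in_distribution Ps P \<longleftrightarrow>
     (\<forall>f :: 'a \<Rightarrow> real. continuous_on UNIV f \<and> bounded (range f) \<longrightarrow>
        (\<lambda>n. integral\<^sup>L (Ps n) f) \<longlonglongrightarrow> integral\<^sup>L P f)"

definition metrizes_convergence_in_distribution ::
    "('a::topological_space measure \<Rightarrow> 'a measure \<Rightarrow> real) \<Rightarrow> bool" where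
  "metrizes_convergence_in_distribution \<rho> \<longleftrightarrow>
     Metric_space (space (prob_algebra borel)) \<rho> \<and>
     (\<forall>Ps P. (\<forall>n. Ps n \<in> space (prob_algebra borel)) \<and> P \<in> space (prob_algebra borel) \<longrightarrow>
        (converges_in_distribution Ps P \<longleftrightarrow> (\<lambda>n. \<rho> (Ps n) P) \<longlonglongrightarrow> 0))"

definition limit_dist :: "'a measure \<Rightarrow> 'a measure \<Rightarrow> ennreal \<Rightarrow> 'a measure" where
  "limit_dist H P0 t =
     (if t = \<infinity> then H else mixture (enn2real t / (1 + enn2real t)) H P0)"

definition exponential_limit :: "real \<Rightarrow> real" where
  "exponential_limit c = (THE t. t > 0 \<and> 1 / t - ln (1 + 1 / t) = c)"

end

theory Submission
  imports Defs
begin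

text \<open>
  Given \<open>\<alpha>\<close> and the data, \<open>P\<close> is a Dirichlet process of total mass \<open>\<alpha> + N\<close> around the base distribution
  \<open>u H + (1 - u) P\<^sub>N\<close>, where \<open>P\<^sub>N\<close> is the empirical measure and \<open>u = \<alpha> / (\<alpha> + N)\<close>.  The total mass is at
  least \<open>N\<close>, so \<open>P\<close> is close to its base distribution (\<open>dirichlet_process_deviation\<close>), and \<open>P\<^sub>N\<close> is close to
  \<open>P0\<close> by the law of large numbers (\<open>AE_empirical_measure_tendsto\<close>).  Thus \<open>P\<close> is close to
  \<open>u H + (1 - u) P0\<close>, and everything depends on where the posterior puts the weight \<open>u\<close>, or equivalently
  the ratio \<open>t = \<alpha> / N\<close>.

  The data have no ties almost surely, so the likelihood of \<open>\<alpha>\<close> is the product of the factors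
  \<open>\<alpha> / (\<alpha> + i)\<close> for \<open>i < N\<close>.  At \<open>\<alpha> = t N\<close> a Riemann sum argument shows that it behaves like
  \<open>exp (- N \<phi>(t))\<close> with the convex decreasing rate \<open>\<phi>(t) = (1 + t) ln (1 + 1 / t) - 1\<close>
  (\<open>all_distinct_prob_bounds\<close>).  The absence of ties therefore favours large \<open>t\<close> exponentially in \<open>N\<close>, and
  only the tail of the prior can counteract this.
  A heavy tail is negligible at this scale, and \<open>t\<close> escapes to infinity (\<open>heavy_tail_concentrates\<close>).  A
  tail \<open>exp (- c \<alpha>)\<close> adds \<open>c t\<close> to the rate, and the posterior settles at the minimum of \<open>c t + \<phi>(t)\<close>,
  that is, at the solution of \<open>1 / t - ln (1 + 1 / t) = c\<close> (\<open>exponential_tail_concentrates\<close>).  A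
  light tail outweighs the likelihood at every positive \<open>t\<close> (\<open>light_tail_concentrates\<close>).

  The metric enters only through its convergent sequences.  By the portmanteau theorem and an
  argument by contradiction, an \<open>\<epsilon>\<close>-ball contains a set that is defined by the masses of
  finitely many open sets (\<open>finitely_many_sets_control_metric\<close>), to which the previous estimates apply.
\<close>

section \<open>Weak convergence from countably many open sets\<close>

lemma card_below_bounds:
  fixes y :: real
  assumes "0 \<le> y" "y \<le> real k"
  shows "real (card {i\<in>{1..k}. real i < y}) \<le> y" "y \<le> 1 + real (card {i\<in>{1..k}. real i < y})"
proof -
  have "{i\<in>{1..k}. real i < y} = {1..nat (\<lceil>y\<rceil> - 1)}"
    using assms by (auto; linarith)
  then have "real (card {i\<in>{1..k}. real i < y}) = real (nat (\<lceil>y\<rceil> - 1))"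
    by simp
  with assms show "real (card {i\<in>{1..k}. real i < y}) \<le> y" "y \<le> 1 + real (card {i\<in>{1..k}. real i < y})"
    by linarith+
qed

text \<open>
  A function with values in \<open>[0, 1]\<close> differs by at most \<open>1 / k\<close> from the average of the indicators of
  its level sets \<open>{f > i / k}\<close>.  For continuous \<open>f\<close> these sets are open, so the lemma turns lower
  bounds for the mass of open sets into lower bounds for integrals.
\<close>

lemma integral_staircase_bounds:
  fixes f :: "'a::topological_space \<Rightarrow> real"
  assumes P: "prob_space P" "sets P = sets borel"
    and f [measurable]: "f \<in> borel_measurable borel" and f01: "\<And>x. 0 \<le> f x" "\<And>x. f x \<le> 1"
    and k: "k > 0"
  shows "(\<Sum>i\<in>{1..k}. measure P {x. f x > real i / real k}) / real k \<le> integral\<^sup>L P f"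
    and "integral\<^sup>L P f \<le> 1 / real k + (\<Sum>i\<in>{1..k}. measure P {x. f x > real i / real k}) / real k"
proof -
  interpret prob_space P by fact
  note P(2) [measurable_cong]
  define s where "s x = (\<Sum>i\<in>{1..k}. indicat_real {x. f x > real i / real k} x)" for x
  have sp: "space P = UNIV" using sets_eq_imp_space_eq[OF P(2)] by simp
  have lev: "{x. f x > real i / real k} \<in> sets P" for i
    unfolding P(2) by measurable
  have s_int: "integral\<^sup>L P s = (\<Sum>i\<in>{1..k}. measure P {x. f x > real i / real k})"
    unfolding s_def using lev
    by (subst Bochner_Integration.integral_sum)
       (auto simp: sp emeasure_eq_measure intro!: integrable_real_indicator)
  have int_s: "integrable P s"
    unfolding s_def using lev
    by (intro Bochner_Integration.integrable_sum integrable_real_indicator) (auto simp: emeasure_eq_measure)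
  have int_f: "integrable P f"
    by (rule integrable_const_bound[where B=1]) (use f01 in auto)
  have s_card: "s x = real (card {i\<in>{1..k}. real i < real k * f x})" for x
  proof -
    have "s x = (\<Sum>i\<in>{1..k}. if real i < real k * f x then 1 else 0)"
      unfolding s_def using k by (intro sum.cong) (auto simp: indicator_def field_simps)
    also have "\<dots> = real (card {i\<in>{1..k}. real i < real k * f x})"
      by (simp add: sum.If_cases Collect_conj_eq[symmetric] Int_def)
    finally show ?thesis .
  qed
  have kf: "0 \<le> real k * f x" "real k * f x \<le> real k" for x
    using f01[of x] by (auto simp: mult_left_le)
  have "integral\<^sup>L P s \<le> integral\<^sup>L P (\<lambda>x. real k * f x)"
    using card_below_bounds(1)[OF kf, folded s_card] int_s int_f by (intro integral_mono) auto
  then show "(\<Sum>i\<in>{1..k}. measure P {x. f x > real i / real k}) / real k \<le> integral\<^sup>L P f"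
    using k by (simp add: s_int field_simps)
  have "integral\<^sup>L P (\<lambda>x. real k * f x) \<le> integral\<^sup>L P (\<lambda>x. 1 + s x)"
    using card_below_bounds(2)[OF kf, folded s_card] int_s int_f by (intro integral_mono) auto
  also have "\<dots> = 1 + integral\<^sup>L P s"
    using int_s by (subst Bochner_Integration.integral_add) (auto simp: prob_space)
  finally show "integral\<^sup>L P f \<le> 1 / real k + (\<Sum>i\<in>{1..k}. measure P {x. f x > real i / real k}) / real k"
    using k by (simp add: s_int field_simps)
qed

lemma integral_lower_semicontinuous:
  fixes f :: "'a::topological_space \<Rightarrow> real"
  assumes Ps: "\<And>n. prob_space (Ps n)" "\<And>n. sets (Ps n) = sets borel"
    and Q: "prob_space Q" "sets Q = sets borel"
    and lim: "\<And>U e. open U \<Longrightarrow> e > 0 \<Longrightarrow> \<forall>\<^sub>F n in sequentially. measure Q U - e < measure (Ps n) U"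
    and f: "continuous_on UNIV f" "\<And>x. 0 \<le> f x" "\<And>x. f x \<le> 1"
    and e: "e > 0"
  shows "\<forall>\<^sub>F n in sequentially. integral\<^sup>L Q f - e < integral\<^sup>L (Ps n) f"
proof -
  obtain k :: nat where k: "k > 0" "1 / real k < e / 2"
    using nat_approx_posE[of "e / 2"] e by (metis half_gt_zero zero_less_Suc)
  have fm: "f \<in> borel_measurable borel" using f(1) by (rule borel_measurable_continuous_onI)
  have op: "open {x. f x > real i / real k}" for i
    by (intro open_Collect_less continuous_intros f(1))
  have "\<forall>\<^sub>F n in sequentially. \<forall>i\<in>{1..k}.
      measure Q {x. f x > real i / real k} - e / 2 < measure (Ps n) {x. f x > real i / real k}"
    using e by (intro eventually_ball_finite ballI lim op) auto
  then show ?thesis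
  proof eventually_elim
    case (elim n)
    define q where "q = (\<Sum>i\<in>{1..k}. measure Q {x. f x > real i / real k})"
    define p where "p = (\<Sum>i\<in>{1..k}. measure (Ps n) {x. f x > real i / real k})"
    have "q \<le> (\<Sum>i\<in>{1..k}. measure (Ps n) {x. f x > real i / real k} + e / 2)"
      unfolding q_def using elim by (intro sum_mono) force
    also have "\<dots> = p + real k * (e / 2)"
      by (simp add: sum.distrib p_def)
    finally have "q / real k \<le> p / real k + e / 2"
      using k by (simp add: field_simps)
    moreover have "integral\<^sup>L Q f \<le> 1 / real k + q / real k"
      unfolding q_def by (rule integral_staircase_bounds[OF Q fm f(2,3) k(1)])
    moreover have "p / real k \<le> integral\<^sup>L (Ps n) f"
      unfolding p_def by (rule integral_staircase_bounds[OF Ps fm f(2,3) k(1)])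
    ultimately show ?case using k by linarith
  qed
qed

text \<open>
  The portmanteau theorem in the direction needed here.  Lower semicontinuity of the integral,
  applied to the rescalings of \<open>f\<close> and of \<open>-f\<close> to \<open>[0, 1]\<close>, bounds the limit from both sides.
\<close>

lemma converges_in_distribution_if_liminf_open:
  fixes Ps :: "nat \<Rightarrow> 'a::topological_space measure"
  assumes Ps: "\<And>n. prob_space (Ps n)" "\<And>n. sets (Ps n) = sets borel"
    and Q: "prob_space Q" "sets Q = sets borel"
    and lim: "\<And>U e. open U \<Longrightarrow> e > 0 \<Longrightarrow> \<forall>\<^sub>F n in sequentially. measure Q U - e < measure (Ps n) U"
  shows "converges_in_distribution Ps Q"
  unfolding converges_in_distribution_def
proof (intro allI impI, elim conjE)
  fix f :: "'a \<Rightarrow> real" assume f: "continuous_on UNIV f" "bounded (range f)"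
  obtain C where C: "C > 0" "\<And>x. \<bar>f x\<bar> \<le> C"
    using f(2) unfolding bounded_pos by auto
  have fm: "f \<in> borel_measurable borel" using f(1) by (rule borel_measurable_continuous_onI)
  have affine: "integral\<^sup>L P (\<lambda>x. (C + s * f x) / (2 * C)) = (C + s * integral\<^sup>L P f) / (2 * C)"
    if "prob_space P" "sets P = sets borel" for P s
  proof -
    interpret prob_space P by fact
    note that(2)[measurable_cong]
    have "integrable P f"
      by (rule integrable_const_bound[where B=C]) (use C fm in auto)
    then show ?thesis by (simp add: prob_space)
  qed
  have one_sided: "\<forall>\<^sub>F n in sequentially. s * integral\<^sup>L Q f - e < s * integral\<^sup>L (Ps n) f"
    if s: "\<bar>s\<bar> = 1" and e: "e > 0" for s e
  proof -
    have b: "\<bar>s * f x\<bar> \<le> C" for x using C(2)[of x] s by (simp add: abs_mult)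
    have "\<forall>\<^sub>F n in sequentially. integral\<^sup>L Q (\<lambda>x. (C + s * f x) / (2 * C)) - e / (2 * C)
        < integral\<^sup>L (Ps n) (\<lambda>x. (C + s * f x) / (2 * C))"
    proof (rule integral_lower_semicontinuous[OF Ps Q lim])
      show "continuous_on UNIV (\<lambda>x. (C + s * f x) / (2 * C))"
        using C by (intro continuous_intros f(1)) auto
      show "0 \<le> (C + s * f x) / (2 * C)" "(C + s * f x) / (2 * C) \<le> 1" for x
        using C b[of x] by (auto simp: field_simps abs_le_iff)
    qed (use C e in auto)
    then show ?thesis
      unfolding affine[OF Ps] affine[OF Q]
      by eventually_elim (use C in \<open>simp add: diff_divide_distrib[symmetric] divide_less_cancel\<close>)
  qed
  show "(\<lambda>n. integral\<^sup>L (Ps n) f) \<longlonglongrightarrow> integral\<^sup>L Q f"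
  proof (rule tendstoI)
    fix e :: real assume "e > 0"
    from eventually_conj[OF one_sided[OF _ this, of 1] one_sided[OF _ this, of "-1"]]
    show "\<forall>\<^sub>F n in sequentially. dist (integral\<^sup>L (Ps n) f) (integral\<^sup>L Q f) < e"
      by (rule eventually_mono) (auto simp: dist_real_def)
  qed
qed

text \<open>
  An open set is the increasing union of finite unions of basic sets, so continuity from below
  applies.
\<close>

lemma inner_approximation_by_finite_unions:
  assumes Q: "prob_space Q" "sets Q = sets borel"
    and B: "topological_basis B" "countable B" and U: "open U" and e: "e > 0"
  shows "\<exists>S. finite S \<and> S \<subseteq> B \<and> \<Union>S \<subseteq> U \<and> measure Q U - e < measure Q (\<Union>S)"
proof -
  interpret prob_space Q by fact
  obtain B' where B': "B' \<subseteq> B" "\<Union>B' = U"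
    using B(1) U unfolding topological_basis_def by auto
  have opB: "open X" if "X \<in> B" for X using B(1) that by (rule topological_basis_open)
  show ?thesis
  proof (cases "B' = {}")
    case True
    then show ?thesis using B' e by (intro exI[of _ "{}"]) auto
  next
    case False
    have cB': "countable B'" using B' B(2) countable_subset by auto
    define F where "F n = from_nat_into B' ` {..<n::nat}" for n
    have FB: "F n \<subseteq> B'" for n
      unfolding F_def using from_nat_into[OF False] by auto
    have un: "(\<Union>n. \<Union>(F n)) = U"
    proof -
      have "(\<Union>n. \<Union>(F n)) = \<Union>(range (from_nat_into B'))"
        unfolding F_def by auto
      then show ?thesis using range_from_nat_into[OF False cB'] B' by simp
    qed
    have "(\<lambda>n. measure Q (\<Union>(F n))) \<longlonglongrightarrow> measure Q (\<Union>n. \<Union>(F n))"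
    proof (rule finite_Lim_measure_incseq)
      show "range (\<lambda>n. \<Union>(F n)) \<subseteq> sets Q"
        unfolding Q(2) using FB B' opB by (intro subsetI) (force intro!: borel_open open_Union)
      show "incseq (\<lambda>n. \<Union>(F n))"
        unfolding F_def by (intro monoI) (force)
    qed
    then have "\<forall>\<^sub>F n in sequentially. measure Q U - e < measure Q (\<Union>(F n))"
      unfolding un using e by (intro order_tendstoD(1)) auto
    then obtain n where "measure Q U - e < measure Q (\<Union>(F n))"
      by (auto simp: eventually_sequentially)
    then show ?thesis
      using FB[of n] B' by (intro exI[of _ "F n"]) (auto simp: F_def)
  qed
qed

lemma converges_in_distribution_if_finite_unions:
  fixes Ps :: "nat \<Rightarrow> 'a::topological_space measure"
  assumes B: "topological_basis B" "countable B"
    and Ps: "\<And>n. prob_space (Ps n)" "\<And>n. sets (Ps n) = sets borel"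
    and Q: "prob_space Q" "sets Q = sets borel"
    and lim: "\<And>S. finite S \<Longrightarrow> S \<subseteq> B \<Longrightarrow> (\<lambda>n. measure (Ps n) (\<Union>S)) \<longlonglongrightarrow> measure Q (\<Union>S)"
  shows "converges_in_distribution Ps Q"
proof (rule converges_in_distribution_if_liminf_open[OF Ps Q])
  fix U :: "'a set" and e :: real assume U: "open U" and e: "e > 0"
  obtain S where S: "finite S" "S \<subseteq> B" "\<Union>S \<subseteq> U" "measure Q U - e < measure Q (\<Union>S)"
    using inner_approximation_by_finite_unions[OF Q B U e] by auto
  have "\<forall>\<^sub>F n in sequentially. measure Q U - e < measure (Ps n) (\<Union>S)"
    using lim[OF S(1,2)] S(4) by (rule order_tendstoD(1))
  then show "\<forall>\<^sub>F n in sequentially. measure Q U - e < measure (Ps n) U"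
  proof eventually_elim
    case (elim n)
    interpret prob_space "Ps n" by fact
    have "measure (Ps n) (\<Union>S) \<le> measure (Ps n) U"
      using S(3) U by (intro finite_measure_mono) (auto simp: Ps)
    with elim show ?case by simp
  qed
qed

lemma space_prob_algebra_borel:
  "P \<in> space (prob_algebra borel) \<longleftrightarrow> prob_space P \<and> sets P = sets borel"
  by (auto simp: space_prob_algebra)

text \<open>
  This replaces the metric, of which only the convergent sequences are known, by finitely many
  evaluations \<open>P \<mapsto> P A\<close>, whose laws a Dirichlet process prescribes.  If no finite family worked,
  then along an enumeration of the finite unions of basic sets there would be \<open>P\<^sub>n\<close> that agree with
  \<open>Q\<close> up to \<open>1 / (n + 1)\<close> on the first \<open>n\<close> sets but stay further than \<open>\<epsilon>\<close> away; such a sequence converges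
  in distribution to \<open>Q\<close>, a contradiction.
\<close>

lemma finitely_many_sets_control_metric:
  fixes \<rho> :: "'a::topological_space measure \<Rightarrow> 'a measure \<Rightarrow> real"
  assumes \<rho>: "metrizes_convergence_in_distribution \<rho>"
    and B: "topological_basis B" "countable B"
    and Q: "Q \<in> space (prob_algebra borel)" and \<epsilon>: "\<epsilon> > 0"
  shows "\<exists>F \<eta>. finite F \<and> (\<forall>A\<in>F. \<exists>S. finite S \<and> S \<subseteq> B \<and> A = \<Union>S) \<and> \<eta> > 0 \<and>
    {P \<in> space (prob_algebra borel). \<rho> P Q > \<epsilon>} \<subseteq>
      (\<Union>A\<in>F. {P \<in> space (prob_algebra borel). \<bar>measure P A - measure Q A\<bar> > \<eta>})"
proof (rule ccontr)
  assume contra: "\<not> ?thesis"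
  define \<A> where "\<A> = Union ` {S. finite S \<and> S \<subseteq> B}"
  have \<A>: "countable \<A>" "\<A> \<noteq> {}"
    unfolding \<A>_def using B(2) by (auto intro!: countable_Collect_finite_subset)
  define a where "a = from_nat_into \<A>"
  have ra: "range a = \<A>" unfolding a_def using \<A> by (simp add: range_from_nat_into)
  have a_union: "\<exists>S. finite S \<and> S \<subseteq> B \<and> a i = \<Union>S" for i
  proof -
    have "a i \<in> \<A>" unfolding ra[symmetric] by (rule rangeI)
    then show ?thesis unfolding \<A>_def by auto
  qed
  have ex: "\<exists>P. P \<in> space (prob_algebra borel) \<and> \<rho> P Q > \<epsilon> \<and>
      (\<forall>i<n. \<bar>measure P (a i) - measure Q (a i)\<bar> \<le> 1 / real (Suc n))" for n
  proof (rule ccontr)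
    assume no: "\<nexists>P. P \<in> space (prob_algebra borel) \<and> \<rho> P Q > \<epsilon> \<and>
      (\<forall>i<n. \<bar>measure P (a i) - measure Q (a i)\<bar> \<le> 1 / real (Suc n))"
    have "\<forall>A\<in>a ` {..<n}. \<exists>S. finite S \<and> S \<subseteq> B \<and> A = \<Union>S"
      using a_union by auto
    moreover have "{P \<in> space (prob_algebra borel). \<rho> P Q > \<epsilon>} \<subseteq>
        (\<Union>A\<in>a ` {..<n}. {P \<in> space (prob_algebra borel).
           \<bar>measure P A - measure Q A\<bar> > 1 / real (Suc n)})"
    proof
      fix P assume P: "P \<in> {P \<in> space (prob_algebra borel). \<rho> P Q > \<epsilon>}"
      with no have "\<not> (\<forall>i<n. \<bar>measure P (a i) - measure Q (a i)\<bar> \<le> 1 / real (Suc n))" by blast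
      then obtain i where "i < n" "\<bar>measure P (a i) - measure Q (a i)\<bar> > 1 / real (Suc n)"
        by (auto simp only: not_all not_imp not_le)
      with P show "P \<in> (\<Union>A\<in>a ` {..<n}. {P \<in> space (prob_algebra borel).
           \<bar>measure P A - measure Q A\<bar> > 1 / real (Suc n)})" by blast
    qed
    moreover have "1 / real (Suc n) > 0" "finite (a ` {..<n})" by auto
    ultimately show False
      using contra[unfolded not_ex, THEN spec, THEN spec, of "a ` {..<n}" "1 / real (Suc n)"]
      by (simp only: simp_thms)
  qed
  have "\<exists>Ps. \<forall>n. Ps n \<in> space (prob_algebra borel) \<and> \<rho> (Ps n) Q > \<epsilon> \<and>
      (\<forall>i<n. \<bar>measure (Ps n) (a i) - measure Q (a i)\<bar> \<le> 1 / real (Suc n))"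
    by (intro choice allI ex)
  then obtain Ps where Ps: "\<And>n. Ps n \<in> space (prob_algebra borel)" "\<And>n. \<rho> (Ps n) Q > \<epsilon>"
      "\<And>n i. i < n \<Longrightarrow> \<bar>measure (Ps n) (a i) - measure Q (a i)\<bar> \<le> 1 / real (Suc n)"
    by blast
  have "converges_in_distribution Ps Q"
  proof (rule converges_in_distribution_if_finite_unions[OF B])
    fix S assume "finite S" "S \<subseteq> B"
    then have "\<Union>S \<in> range a" unfolding ra \<A>_def by simp
    then obtain i where i: "\<Union>S = a i" by (rule rangeE)
    have "(\<lambda>n. measure (Ps n) (a i) - measure Q (a i)) \<longlonglongrightarrow> 0"
    proof (rule tendsto_0_le[OF lim_inverse_n', where K=1])
      show "\<forall>\<^sub>F n in sequentially. norm (measure (Ps n) (a i) - measure Q (a i)) \<le> norm (1 / real n) * 1"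
        using eventually_gt_at_top[of i]
      proof eventually_elim
        case (elim n)
        have "1 / real (Suc n) \<le> 1 / real n" using elim by (intro divide_left_mono) auto
        then show ?case using Ps(3)[OF elim] by simp
      qed
    qed
    then show "(\<lambda>n. measure (Ps n) (\<Union>S)) \<longlonglongrightarrow> measure Q (\<Union>S)"
      unfolding i by (simp add: LIM_zero_iff)
  qed (use Ps(1) Q in \<open>auto simp: space_prob_algebra_borel\<close>)
  then have "(\<lambda>n. \<rho> (Ps n) Q) \<longlonglongrightarrow> 0"
    using \<rho> Ps(1) Q unfolding metrizes_convergence_in_distribution_def by blast
  then have "\<forall>\<^sub>F n in sequentially. \<rho> (Ps n) Q < \<epsilon>"
    using \<epsilon> by (rule order_tendstoD(2))
  then show False using Ps(2) by (auto simp: eventually_sequentially dest: less_asym)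
qed

section \<open>Concentration of the Dirichlet process around its base distribution\<close>

lemma sets_gamma_dist [simp, measurable_cong]: "sets (gamma_dist s) = sets borel"
  by (simp add: gamma_dist_def)

lemma space_gamma_dist [simp]: "space (gamma_dist s) = UNIV"
  by (simp add: gamma_dist_def)

lemma nn_integral_gamma_dist_power:
  assumes "s > 0"
  shows "(\<integral>\<^sup>+x. ennreal (x ^ n) \<partial>gamma_dist s) = ennreal (Gamma (s + real n) / Gamma s)"
proof -
  have G: "Gamma s > 0" "Gamma (s + real n) > 0" using assms by (auto intro: Gamma_real_pos)
  have "(\<integral>\<^sup>+x. ennreal (x ^ n) \<partial>gamma_dist s) =
      (\<integral>\<^sup>+x. ennreal (indicator {0<..} x * (x powr (s - 1) * exp (- x) / Gamma s)) * ennreal (x ^ n) \<partial>lborel)"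
    unfolding gamma_dist_def using assms by (simp add: nn_integral_density)
  also have "\<dots> = (\<integral>\<^sup>+x. ennreal (1 / Gamma s) * ennreal (indicator {0..} x * x powr ((s + real n) - 1) / exp x) \<partial>lborel)"
  proof (rule nn_integral_cong)
    fix x :: real
    show "ennreal (indicator {0<..} x * (x powr (s - 1) * exp (- x) / Gamma s)) * ennreal (x ^ n) =
        ennreal (1 / Gamma s) * ennreal (indicator {0..} x * x powr ((s + real n) - 1) / exp x)"
    proof (cases "x > 0")
      case True
      have "x powr ((s - 1) + real n) = x powr (s - 1) * x ^ n"
        using True by (simp add: powr_add powr_realpow del: add_diff_eq diff_add_eq)
      then have "x powr ((s + real n) - 1) = x powr (s - 1) * x ^ n"
        by (simp add: algebra_simps)
      then show ?thesis
        using True G by (simp add: ennreal_mult[symmetric] exp_minus field_simps)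
    next
      case False
      then show ?thesis by (auto simp: indicator_def not_less)
    qed
  qed
  also have "\<dots> = ennreal (1 / Gamma s) * ennreal (Gamma (s + real n))"
    using assms by (subst nn_integral_cmult) (auto simp: Gamma_conv_nn_integral_real)
  finally show ?thesis
    using G by (simp add: ennreal_mult[symmetric])
qed

lemma prob_space_gamma_dist: "prob_space (gamma_dist s)"
proof (cases "s > 0")
  case True
  have "emeasure (gamma_dist s) UNIV = 1"
    using nn_integral_gamma_dist_power[OF True, of 0] Gamma_real_pos[OF True]
    by (simp add: nn_integral_const)
  then show ?thesis by (intro prob_spaceI) simp
next
  case False
  then show ?thesis by (simp add: gamma_dist_def prob_space_return)
qed

lemma gamma_dist_moment:
  assumes "s > 0"
  shows "integrable (gamma_dist s) (\<lambda>x. x ^ n)"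
    and "integral\<^sup>L (gamma_dist s) (\<lambda>x. x ^ n) = Gamma (s + real n) / Gamma s"
proof -
  have G: "Gamma s > 0" "Gamma (s + real n) > 0" using assms by (auto intro: Gamma_real_pos)
  have "AE x in gamma_dist s. 0 < x"
    unfolding gamma_dist_def using assms by (auto simp: AE_density indicator_def)
  then have nonneg: "AE x in gamma_dist s. 0 \<le> x ^ n"
    by eventually_elim simp
  have "has_bochner_integral (gamma_dist s) (\<lambda>x. x ^ n) (Gamma (s + real n) / Gamma s)"
    by (rule has_bochner_integral_nn_integral)
       (use nonneg G assms in \<open>auto simp: nn_integral_gamma_dist_power\<close>)
  then show "integrable (gamma_dist s) (\<lambda>x. x ^ n)"
    "integral\<^sup>L (gamma_dist s) (\<lambda>x. x ^ n) = Gamma (s + real n) / Gamma s"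
    by (auto simp: has_bochner_integral_iff)
qed

text \<open>
  Chebyshev's inequality; mean and variance of this distribution are both equal to the shape \<open>s\<close>.
\<close>

lemma gamma_dist_deviation:
  assumes "s \<ge> 0" "r > 0"
  shows "measure (gamma_dist s) {x. \<bar>x - s\<bar> \<ge> r} \<le> s / r\<^sup>2"
proof (cases "s > 0")
  case True
  interpret prob_space "gamma_dist s" by (rule prob_space_gamma_dist)
  have G1: "Gamma (s + 1) = s * Gamma s" using True by (intro Gamma_plus1) auto
  have "Gamma ((s + 1) + 1) = (s + 1) * Gamma (s + 1)"
    using True by (intro Gamma_plus1) auto
  then have "Gamma (s + 2) = (s + 1) * Gamma (s + 1)"
    by (simp add: add.assoc)
  with G1 have ratios: "Gamma (s + 1) / Gamma s = s" "Gamma (s + 2) / Gamma s = s * (s + 1)"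
    using Gamma_real_pos[OF True] by auto
  have mean: "expectation (\<lambda>x. x) = s"
    using gamma_dist_moment(2)[OF True, of 1] ratios(1) by simp
  have second: "expectation (\<lambda>x. x ^ 2) = s * (s + 1)"
    using gamma_dist_moment(2)[OF True, of 2] ratios(2) by simp
  have int: "integrable (gamma_dist s) (\<lambda>x. x)" "integrable (gamma_dist s) (\<lambda>x. x ^ 2)"
    using gamma_dist_moment(1)[OF True, of 1] gamma_dist_moment(1)[OF True, of 2] by simp_all
  have "variance (\<lambda>x. x) = s * (s + 1) - s\<^sup>2"
    using variance_eq[OF int] by (simp only: mean second)
  also have "\<dots> = s" by (simp add: algebra_simps power2_eq_square)
  finally have "variance (\<lambda>x. x) = s" .
  then show ?thesis
    using Chebyshev_inequality[of "\<lambda>x. x" r] int(2) assms(2) unfolding mean by simp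
next
  case False
  with assms have "s = 0" by simp
  then show ?thesis using assms
    by (simp add: gamma_dist_def measure_return)
qed

text \<open>
  If both gamma variables are within relative error \<open>r\<close> of their means, measured against the total
  mass \<open>a\<close>, the normalised variable is close to its nominal value.  Applied pathwise, this reduces
  the deviations of a ratio to those of the two gamma variables separately.
\<close>

lemma ratio_close:
  fixes x y p a r :: real
  assumes "\<bar>x - a * p\<bar> < r * a" "\<bar>y - a * (1 - p)\<bar> < r * a" "0 \<le> p" "p \<le> 1" "a > 0" "0 < r" "r \<le> 1 / 4"
  shows "\<bar>x / (x + y) - p\<bar> \<le> 2 * r"
proof -
  have "x + y \<ge> a - 2 * (r * a)" using assms(1,2) by (simp add: algebra_simps)
  moreover have "r * a \<le> a / 4" using assms(5,7) by simp
  ultimately have sum: "x + y \<ge> a / 2" by linarith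
  with assms(5) have pos: "x + y > 0" by linarith
  have "x - p * (x + y) = (1 - p) * (x - a * p) - p * (y - a * (1 - p))"
    by (simp add: algebra_simps)
  also have "\<bar>\<dots>\<bar> \<le> (1 - p) * \<bar>x - a * p\<bar> + p * \<bar>y - a * (1 - p)\<bar>"
    using assms(3,4) by (intro order.trans[OF abs_triangle_ineq4]) (simp add: abs_mult)
  also have "\<dots> \<le> (1 - p) * (r * a) + p * (r * a)"
    using assms(1-4) by (intro add_mono mult_left_mono) simp_all
  finally have "\<bar>x - p * (x + y)\<bar> \<le> r * a" by (simp add: algebra_simps)
  also have "\<dots> \<le> 2 * r * (x + y)"
    using mult_left_mono[OF sum, of "2 * r"] assms(6) by simp
  finally have "\<bar>x - p * (x + y)\<bar> \<le> 2 * r * (x + y)" .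
  moreover have "x / (x + y) - p = (x - p * (x + y)) / (x + y)"
    using pos by (simp add: field_simps)
  ultimately show ?thesis
    using pos by (simp add: abs_divide pos_divide_le_eq)
qed

text \<open>
  For the partition \<open>{A, -A}\<close> the random mass \<open>P A\<close> is \<open>X / (X + Y)\<close> with gamma variables \<open>X\<close> and
  \<open>Y\<close> of shapes \<open>a G(A)\<close> and \<open>a (1 - G(A))\<close>.  Each deviates from its mean by \<open>r a\<close> or more with
  probability at most its shape divided by \<open>(r a)\<^sup>2\<close>, and the two shapes add up to \<open>a\<close>.
\<close>

lemma dirichlet_process_deviation:
  fixes G :: "'a::topological_space measure"
  assumes D: "is_dirichlet_process a G D" and G: "prob_space G" "sets G = sets borel"
    and A: "A \<in> sets borel" and a: "a > 0" and r: "0 < r" "r \<le> 1 / 4"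
  shows "emeasure D {P \<in> space (prob_algebra borel). \<bar>measure P A - measure G A\<bar> > 2 * r}
    \<le> ennreal (1 / (r\<^sup>2 * a))"
proof -
  interpret G: prob_space G by fact
  define As where "As = [A, - A]"
  define I where "I = {..<length As}"
  define b where "b i = a * measure G (As ! i)" for i
  define p where "p = measure G A"
  have I: "0 \<in> I" "Suc 0 \<in> I" "finite I" "I = {0, Suc 0}" by (auto simp: I_def As_def)
  have spG: "space G = UNIV" using sets_eq_imp_space_eq[OF G(2)] by simp
  have p: "0 \<le> p" "p \<le> 1" by (auto simp: p_def)
  have b: "b 0 = a * p" "b (Suc 0) = a * (1 - p)"
    using G.prob_compl[of A] A spG G(2) by (auto simp: b_def As_def p_def Compl_eq_Diff_UNIV)
  have part: "measurable_partition As"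
    using A unfolding measurable_partition_def As_def
    by (auto simp: disjoint_family_on_def less_Suc_eq)
  have setsD: "sets D = sets (prob_algebra borel)" and spD: "space D = space (prob_algebra borel)"
    and law: "distr D (\<Pi>\<^sub>M i\<in>I. borel) (\<lambda>P. \<lambda>i\<in>I. measure P (As ! i)) = dirichlet_dist I b"
    using D part unfolding is_dirichlet_process_def I_def b_def by (auto dest: sets_eq_imp_space_eq)
  note setsD [measurable_cong]
  define T where "T = {x \<in> space (\<Pi>\<^sub>M i\<in>I. (borel :: real measure)). \<bar>x 0 - p\<bar> > 2 * r}"
  have T: "T \<in> sets (\<Pi>\<^sub>M i\<in>I. borel)"
    unfolding T_def using I(1) by measurable
  have As_sets: "As ! i \<in> sets borel" if "i \<in> I" for i
    using that A by (auto simp: I As_def)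
  have ev: "(\<lambda>P. measure P X) \<in> borel_measurable D" if "X \<in> sets borel" for X
  proof -
    have "(\<lambda>P. measure P X) \<in> borel_measurable (prob_algebra (borel :: 'a measure))"
      unfolding prob_algebra_def using that
      by (intro measurable_restrict_space1 measurable_measure_subprob_algebra) auto
    then show ?thesis using setsD by (simp cong: measurable_cong_sets)
  qed
  have m1: "(\<lambda>P. \<lambda>i\<in>I. measure P (As ! i)) \<in> measurable D (\<Pi>\<^sub>M i\<in>I. borel)"
    by (intro measurable_restrict ev As_sets)
  define W where "W = (\<Pi>\<^sub>M i\<in>I. gamma_dist (b i))"
  interpret W: product_prob_space "\<lambda>i. gamma_dist (b i)" I
    using prob_space_gamma_dist by (intro product_prob_spaceI)
  have W_comp: "(\<lambda>x. x i) \<in> borel_measurable W" if "i \<in> I" for i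
  proof -
    have "(\<lambda>x. x i) \<in> measurable W (gamma_dist (b i))"
      unfolding W_def using that by (rule measurable_component_singleton)
    then show ?thesis by (simp cong: measurable_cong_sets)
  qed
  have m2: "(\<lambda>x. \<lambda>i\<in>I. x i / (\<Sum>j\<in>I. x j)) \<in> measurable W (\<Pi>\<^sub>M i\<in>I. borel)"
    by (intro measurable_restrict borel_measurable_divide borel_measurable_sum W_comp)
  have dev_sets: "{x \<in> space W. \<bar>x i - b i\<bar> \<ge> r * a} \<in> sets W" if i: "i \<in> I" for i
  proof -
    note W_comp[OF i, measurable]
    show ?thesis by measurable
  qed
  have dev: "emeasure W {x \<in> space W. \<bar>x i - b i\<bar> \<ge> r * a} \<le> ennreal (b i / (r * a)\<^sup>2)" if i: "i \<in> I" for i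
  proof -
    have bi: "b i \<ge> 0" using a by (simp add: b_def)
    have "emeasure (gamma_dist (b i)) {x. \<bar>x - b i\<bar> \<ge> r * a}
        = emeasure (distr W (gamma_dist (b i)) (\<lambda>x. x i)) {x. \<bar>x - b i\<bar> \<ge> r * a}"
      unfolding W_def using i by (simp add: W.PiM_component)
    also have "\<dots> = emeasure W ((\<lambda>x. x i) -` {x. \<bar>x - b i\<bar> \<ge> r * a} \<inter> space W)"
      using W_comp[OF i] by (intro emeasure_distr) (auto cong: measurable_cong_sets)
    also have "(\<lambda>x. x i) -` {x. \<bar>x - b i\<bar> \<ge> r * a} \<inter> space W = {x \<in> space W. \<bar>x i - b i\<bar> \<ge> r * a}"
      by auto
    finally have "emeasure W {x \<in> space W. \<bar>x i - b i\<bar> \<ge> r * a}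
        = ennreal (measure (gamma_dist (b i)) {x. \<bar>x - b i\<bar> \<ge> r * a})"
      by (simp add: finite_measure.emeasure_eq_measure[OF prob_space.finite_measure[OF prob_space_gamma_dist]])
    also have "\<dots> \<le> ennreal (b i / (r * a)\<^sup>2)"
      using r a by (intro ennreal_leI gamma_dist_deviation bi) simp
    finally show ?thesis .
  qed
  have "emeasure D {P \<in> space (prob_algebra borel). \<bar>measure P A - p\<bar> > 2 * r}
      = emeasure (distr D (\<Pi>\<^sub>M i\<in>I. borel) (\<lambda>P. \<lambda>i\<in>I. measure P (As ! i))) T"
  proof -
    have "{P \<in> space (prob_algebra borel). \<bar>measure P A - p\<bar> > 2 * r}
        = (\<lambda>P. \<lambda>i\<in>I. measure P (As ! i)) -` T \<inter> space D"
      using I(1) spD by (auto simp: T_def As_def space_PiM)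
    then show ?thesis by (simp add: emeasure_distr[OF m1 T])
  qed
  also have "\<dots> = emeasure W ((\<lambda>x. \<lambda>i\<in>I. x i / (\<Sum>j\<in>I. x j)) -` T \<inter> space W)"
    unfolding law dirichlet_dist_def W_def[symmetric] by (rule emeasure_distr[OF m2 T])
  also have "\<dots> \<le> emeasure W ({x \<in> space W. \<bar>x 0 - b 0\<bar> \<ge> r * a} \<union> {x \<in> space W. \<bar>x (Suc 0) - b (Suc 0)\<bar> \<ge> r * a})"
  proof (intro emeasure_mono subsetI)
    fix x assume x: "x \<in> (\<lambda>x. \<lambda>i\<in>I. x i / (\<Sum>j\<in>I. x j)) -` T \<inter> space W"
    then have "\<bar>x 0 / (\<Sum>j\<in>I. x j) - p\<bar> > 2 * r"
      using I(1) by (simp add: T_def)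
    then have "\<bar>x 0 / (x 0 + x (Suc 0)) - p\<bar> > 2 * r"
      by (simp add: I(4))
    then have "\<not> (\<bar>x 0 - a * p\<bar> < r * a \<and> \<bar>x (Suc 0) - a * (1 - p)\<bar> < r * a)"
      using ratio_close[of "x 0" a p r "x (Suc 0)"] p a r by auto
    then show "x \<in> {x \<in> space W. \<bar>x 0 - b 0\<bar> \<ge> r * a} \<union> {x \<in> space W. \<bar>x (Suc 0) - b (Suc 0)\<bar> \<ge> r * a}"
      using x by (auto simp: b)
  qed (use dev_sets I(1,2) in blast)
  also have "\<dots> \<le> emeasure W {x \<in> space W. \<bar>x 0 - b 0\<bar> \<ge> r * a} + emeasure W {x \<in> space W. \<bar>x (Suc 0) - b (Suc 0)\<bar> \<ge> r * a}"
    using I(1,2) by (intro emeasure_subadditive dev_sets)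
  also have "\<dots> \<le> ennreal (b 0 / (r * a)\<^sup>2) + ennreal (b (Suc 0) / (r * a)\<^sup>2)"
    using I(1,2) by (intro add_mono dev)
  also have "\<dots> = ennreal (1 / (r\<^sup>2 * a))"
    using a p r by (subst ennreal_plus[symmetric]) (auto simp: b field_simps power2_eq_square)
  finally show ?thesis unfolding p_def .
qed

text \<open>
  Upper bounds for event probabilities hold in both cases, since the null measure gives mass 0 to
  every event.
\<close>

lemma dirichlet_process_cases:
  "is_dirichlet_process a G (dirichlet_process a G) \<or> dirichlet_process a G = null_measure (prob_algebra borel)"
  unfolding dirichlet_process_def by (auto intro: someI_ex)

lemma emeasure_dirichlet_process_le_1: "emeasure (dirichlet_process a G) B \<le> 1"
proof (cases "is_dirichlet_process a G (dirichlet_process a G)")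
  case True
  then interpret prob_space "dirichlet_process a G" by (simp add: is_dirichlet_process_def)
  show ?thesis by (rule measure_le_1)
next
  case False
  with dirichlet_process_cases[of a G] show ?thesis by auto
qed

text \<open>
  The event \<open>B\<close> may fail to be measurable; then its \<open>emeasure\<close> is 0.  Hence covering it by
  measurable events bounds it in every case.
\<close>

lemma emeasure_dirichlet_process_le:
  fixes G :: "'a::topological_space measure"
  assumes G: "prob_space G" "sets G = sets borel" and a: "a > 0" and r: "0 < r" "r \<le> 1 / 4"
    and F: "finite F" "F \<subseteq> sets borel"
    and B: "B \<subseteq> (\<Union>A\<in>F. {P \<in> space (prob_algebra borel). \<bar>measure P A - measure G A\<bar> > 2 * r})"
  shows "emeasure (dirichlet_process a G) B \<le> ennreal (real (card F) / (r\<^sup>2 * a))"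
proof (cases "is_dirichlet_process a G (dirichlet_process a G)")
  case True
  define D where "D = dirichlet_process a G"
  have D: "is_dirichlet_process a G D" using True by (simp add: D_def)
  then have setsD: "sets D = sets (prob_algebra borel)" by (simp add: is_dirichlet_process_def)
  define dev where "dev A = {P \<in> space (prob_algebra (borel :: 'a measure)). \<bar>measure P A - measure G A\<bar> > 2 * r}" for A
  have dev: "dev A \<in> sets D" if "A \<in> F" for A
  proof -
    have [measurable]: "(\<lambda>P. measure P A) \<in> borel_measurable (prob_algebra (borel :: 'a measure))"
      unfolding prob_algebra_def using that F
      by (intro measurable_restrict_space1 measurable_measure_subprob_algebra) auto
    show ?thesis unfolding dev_def setsD by measurable
  qed
  have "emeasure D B \<le> emeasure D (\<Union>A\<in>F. dev A)"
    using B F dev unfolding dev_def by (intro emeasure_mono) auto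
  also have "\<dots> \<le> (\<Sum>A\<in>F. emeasure D (dev A))"
    using F dev by (intro emeasure_subadditive_finite) auto
  also have "\<dots> \<le> (\<Sum>A\<in>F. ennreal (1 / (r\<^sup>2 * a)))"
    unfolding dev_def using F by (intro sum_mono dirichlet_process_deviation[OF D G _ a r]) auto
  also have "\<dots> = ennreal (real (card F) / (r\<^sup>2 * a))"
    using a r by (subst sum_ennreal) (auto intro!: divide_nonneg_nonneg)
  finally show ?thesis unfolding D_def .
next
  case False
  with dirichlet_process_cases[of a G] show ?thesis by auto
qed

section \<open>The sample: empirical frequencies and absence of ties\<close>

lemma measure_empirical_measure:
  assumes "A \<in> sets borel"
  shows "measure (empirical_measure N y) A = (\<Sum>i<N. indicat_real A (y i)) / real N"
proof -
  have m: "y \<in> measurable (uniform_count_measure {..<N}) borel"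
    by (auto simp: measurable_def sets_uniform_count_measure space_uniform_count_measure)
  have "measure (empirical_measure N y) A = measure (uniform_count_measure {..<N}) (y -` A \<inter> {..<N})"
    unfolding empirical_measure_def using m assms
    by (subst measure_distr) (auto simp: space_uniform_count_measure)
  also have "\<dots> = real (card (y -` A \<inter> {..<N})) / real N"
    by (subst measure_uniform_count_measure) auto
  also have "real (card (y -` A \<inter> {..<N})) = (\<Sum>i<N. indicat_real A (y i))"
    by (simp add: indicator_def sum.If_cases Int_commute vimage_def Int_def)
  finally show ?thesis .
qed

lemma sets_empirical_measure [simp]: "sets (empirical_measure N y) = sets borel"
  by (simp add: empirical_measure_def)

text \<open>
  The strong law of large numbers for the indicator of \<open>A\<close>: Hoeffding's inequality makes the
  probability of a deviation \<open>\<epsilon>\<close> summable in the sample size, and the Borel-Cantelli lemma applies.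
\<close>

lemma AE_empirical_measure_tendsto:
  fixes Y :: "nat \<Rightarrow> 'w \<Rightarrow> 'a::topological_space"
  assumes M: "prob_space M" and Y_indep: "prob_space.indep_vars M (\<lambda>_. borel) Y UNIV"
    and Y_distr: "\<And>i. distr M borel (Y i) = P0" and A: "A \<in> sets borel"
  shows "AE \<omega> in M. (\<lambda>N. measure (empirical_measure N (\<lambda>i. Y i \<omega>)) A) \<longlonglongrightarrow> measure P0 A"
proof -
  interpret prob_space M by fact
  define X where "X i \<omega> = indicat_real A (Y i \<omega>)" for i \<omega>
  have Ym [measurable]: "Y i \<in> borel_measurable M" for i
    using Y_indep by (auto simp: indep_vars_def)
  note A [measurable]
  have Xm [measurable]: "X i \<in> borel_measurable M" for i
    unfolding X_def by measurable
  have EX: "expectation (X i) = measure P0 A" for i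
  proof -
    have "expectation (X i) = integral\<^sup>L (distr M borel (Y i)) (indicat_real A)"
      unfolding X_def by (subst integral_distr) auto
    also have "\<dots> = measure P0 A"
      using Y_distr[of i] A by (auto simp: Y_distr simp flip: sets_distr[of M borel "Y i"])
    finally show ?thesis .
  qed
  have X_indep: "indep_vars (\<lambda>_. borel) X I" for I
    unfolding X_def
    by (rule indep_vars_compose2[OF indep_vars_subset[OF Y_indep subset_UNIV]]) (use A in measurable)
  define Bad where "Bad \<epsilon> N = {\<omega> \<in> space M. \<bar>(\<Sum>i<N. X i \<omega>) - real N * measure P0 A\<bar> \<ge> \<epsilon> * real N}" for \<epsilon> N
  have Bad_meas: "Bad \<epsilon> N \<in> sets M" for \<epsilon> N
    unfolding Bad_def by measurable
  have hoeffding: "prob (Bad \<epsilon> N) \<le> 2 * exp (- (2 * \<epsilon>\<^sup>2)) ^ N" if "\<epsilon> > 0" "N > 0" for \<epsilon> N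
  proof -
    interpret Hoeffding_ineq M "{..<N}" X "\<lambda>_. 0" "\<lambda>_. 1" "\<Sum>i<N. expectation (X i)"
      by unfold_locales (auto intro: X_indep simp: X_def indicator_def)
    have "prob (Bad \<epsilon> N) \<le> 2 * exp (- 2 * (\<epsilon> * real N)\<^sup>2 / real N)"
      using Hoeffding_ineq_abs_ge[of "\<epsilon> * real N"] that unfolding Bad_def by (simp add: EX)
    also have "- 2 * (\<epsilon> * real N)\<^sup>2 / real N = real N * (- (2 * \<epsilon>\<^sup>2))"
      using that by (simp add: power2_eq_square)
    finally show ?thesis by (simp only: exp_of_nat_mult)
  qed
  have "AE \<omega> in M. \<forall>\<^sub>F N in sequentially. \<omega> \<in> space M - Bad \<epsilon> N" if "\<epsilon> > 0" for \<epsilon>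
  proof (rule borel_cantelli_AE1)
    have "exp (- (2 * \<epsilon>\<^sup>2)) < 1" using that by simp
    then have "summable (\<lambda>N. 2 * exp (- (2 * \<epsilon>\<^sup>2)) ^ N)"
      by (intro summable_mult summable_geometric) simp
    then show "summable (\<lambda>N. prob (Bad \<epsilon> N))"
      by (rule summable_comparison_test_ev[rotated])
         (use hoeffding that in \<open>auto intro!: eventually_mono[OF eventually_gt_at_top[of 0]]\<close>)
  qed (auto simp: Bad_meas emeasure_eq_measure)
  then have "AE \<omega> in M. \<forall>m. \<forall>\<^sub>F N in sequentially. \<omega> \<in> space M - Bad (1 / real (Suc m)) N"
    by (subst AE_all_countable) auto
  then show ?thesis
  proof eventually_elim
    case (elim \<omega>)
    show ?case
    proof (rule tendstoI)
      fix e :: real assume "e > 0"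
      then obtain m where m: "1 / real (Suc m) < e" using nat_approx_posE by blast
      from elim[rule_format, of m] eventually_gt_at_top[of 0]
      show "\<forall>\<^sub>F N in sequentially. dist (measure (empirical_measure N (\<lambda>i. Y i \<omega>)) A) (measure P0 A) < e"
      proof eventually_elim
        case (elim N)
        have "\<bar>(\<Sum>i<N. X i \<omega>) - real N * measure P0 A\<bar> < 1 / real (Suc m) * real N"
          using elim unfolding Bad_def by (auto simp: not_le)
        also have "\<dots> < e * real N" using m elim by (intro mult_strict_right_mono) auto
        finally have "\<bar>(\<Sum>i<N. X i \<omega>) - real N * measure P0 A\<bar> / real N < e"
          using elim by (simp add: divide_less_eq)
        moreover have "\<bar>(\<Sum>i<N. X i \<omega>) - real N * measure P0 A\<bar> / real N
            = \<bar>((\<Sum>i<N. X i \<omega>) - real N * measure P0 A) / real N\<bar>"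
          by (simp add: abs_divide)
        ultimately show ?case
          using elim by (simp add: measure_empirical_measure[OF A] X_def dist_real_def diff_divide_distrib)
      qed
    qed
  qed
qed

text \<open>
  Two independent observations with a diffuse law hit the diagonal with probability 0.
\<close>

lemma AE_all_distinct:
  fixes Y :: "nat \<Rightarrow> 'w \<Rightarrow> 'a::euclidean_space"
  assumes M: "prob_space M" and Y_indep: "prob_space.indep_vars M (\<lambda>_. borel) Y UNIV"
    and Y_distr: "\<And>i. distr M borel (Y i) = P0"
    and no_atoms: "\<And>x. AE y in P0. y \<noteq> x"
  shows "AE \<omega> in M. inj (\<lambda>i. Y i \<omega>)"
proof -
  interpret prob_space M by fact
  have Ym [measurable]: "Y i \<in> borel_measurable M" for i
    using Y_indep by (auto simp: indep_vars_def)
  have setsP0: "sets P0 = sets borel" using Y_distr[of 0] by auto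
  interpret P0: prob_space P0 using prob_space_distr[OF Ym[of 0]] Y_distr[of 0] by simp
  interpret pair_sigma_finite P0 P0 ..
  note setsP0 [measurable_cong]
  have spP0: "space P0 = UNIV" using sets_eq_imp_space_eq[OF setsP0] by simp
  have pair: "AE z in P0 \<Otimes>\<^sub>M P0. snd z \<noteq> fst z"
    by (rule AE_pair_measure) (use no_atoms in auto)
  have pair_law: "distr M (borel \<Otimes>\<^sub>M borel) (\<lambda>\<omega>. (Y i \<omega>, Y j \<omega>)) = P0 \<Otimes>\<^sub>M P0" if "i \<noteq> j" for i j
  proof -
    have "indep_var borel ((\<lambda>x. x i) \<circ> (\<lambda>\<omega>. \<lambda>k\<in>{i}. Y k \<omega>)) borel ((\<lambda>x. x j) \<circ> (\<lambda>\<omega>. \<lambda>k\<in>{j}. Y k \<omega>))"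
      by (rule indep_var_compose[OF indep_var_restrict[OF Y_indep]]) (use that in auto)
    then have "indep_var borel (Y i) borel (Y j)"
      by (simp add: o_def)
    then show ?thesis by (simp add: indep_var_distribution_eq Y_distr)
  qed
  have law: "AE z in distr M (borel \<Otimes>\<^sub>M borel) (\<lambda>\<omega>. (Y i \<omega>, Y j \<omega>)). snd z \<noteq> fst z"
    if "i \<noteq> j" for i j
    unfolding pair_law[OF that] by (rule pair)
  have "AE \<omega> in M. snd (Y i \<omega>, Y j \<omega>) \<noteq> fst (Y i \<omega>, Y j \<omega>)" if "i \<noteq> j" for i j
    by (rule AE_distrD[OF _ law[OF that]]) measurable
  then have "AE \<omega> in M. i \<noteq> j \<longrightarrow> Y j \<omega> \<noteq> Y i \<omega>" for i j by (cases "i = j") auto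
  then have "AE \<omega> in M. \<forall>i j. i \<noteq> j \<longrightarrow> Y j \<omega> \<noteq> Y i \<omega>"
    by (simp add: AE_all_countable)
  then show ?thesis by eventually_elim (metis injI)
qed

lemma prob_space_empirical_measure:
  assumes "N > 0"
  shows "prob_space (empirical_measure N y)"
proof -
  have "prob_space (uniform_count_measure {..<N})"
    using assms by (intro prob_space_uniform_count_measure) auto
  then show ?thesis
    unfolding empirical_measure_def
    by (rule prob_space.prob_space_distr)
       (auto simp: measurable_def sets_uniform_count_measure space_uniform_count_measure)
qed

section \<open>The probability that all observations are distinct\<close>

text \<open>
  The probability that \<open>N\<close> observations from a Dirichlet process with concentration \<open>\<alpha>\<close> and diffuse
  base distribution have no ties (Polya urn): observation number \<open>i\<close>, counted from 0, is a fresh draw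
  with probability \<open>\<alpha> / (\<alpha> + i)\<close>.
\<close>

definition all_distinct_prob :: "nat \<Rightarrow> real \<Rightarrow> real" where
  "all_distinct_prob N \<alpha> = (\<Prod>i<N. \<alpha> / (\<alpha> + real i))"

text \<open>
  With \<open>N\<close> distinct values, the likelihood of \<open>\<alpha>\<close> is this probability.
\<close>

lemma all_distinct_prob_Gamma:
  assumes "\<alpha> > 0"
  shows "\<alpha> ^ N * Gamma \<alpha> / Gamma (\<alpha> + real N) = all_distinct_prob N \<alpha>"
proof -
  have "pochhammer \<alpha> N = Gamma (\<alpha> + real N) / Gamma \<alpha>"
    using assms by (intro pochhammer_Gamma) auto
  then have "\<alpha> ^ N * Gamma \<alpha> / Gamma (\<alpha> + real N) = \<alpha> ^ N / pochhammer \<alpha> N"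
    by simp
  also have "\<dots> = all_distinct_prob N \<alpha>"
    by (simp add: all_distinct_prob_def pochhammer_prod prod_dividef atLeast0LessThan)
  finally show ?thesis .
qed

lemma all_distinct_prob_measurable [measurable]: "all_distinct_prob N \<in> borel_measurable borel"
  unfolding all_distinct_prob_def by measurable

lemma all_distinct_prob_pos: "\<alpha> > 0 \<Longrightarrow> all_distinct_prob N \<alpha> > 0"
  unfolding all_distinct_prob_def by (intro prod_pos) (auto intro!: divide_pos_pos)

lemma all_distinct_prob_le_1: "\<alpha> > 0 \<Longrightarrow> all_distinct_prob N \<alpha> \<le> 1"
  unfolding all_distinct_prob_def by (intro prod_le_1) auto

lemma all_distinct_prob_mono:
  assumes "0 < \<alpha>" "\<alpha> \<le> \<beta>"
  shows "all_distinct_prob N \<alpha> \<le> all_distinct_prob N \<beta>"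
  unfolding all_distinct_prob_def
proof (intro prod_mono conjI)
  fix i
  have "\<alpha> * real i \<le> \<beta> * real i" using assms by (intro mult_right_mono) auto
  then show "\<alpha> / (\<alpha> + real i) \<le> \<beta> / (\<beta> + real i)"
    using assms by (subst frac_le_eq) (auto simp: divide_le_0_iff algebra_simps)
qed (use assms in auto)

text \<open>
  The integral of \<open>ln (1 + s / t)\<close> over \<open>s\<close> from 0 to 1, which is the limit of
  \<open>- ln (all_distinct_prob N (t * N)) / N\<close>.
\<close>

definition distinct_rate :: "real \<Rightarrow> real" where
  "distinct_rate t = (1 + t) * ln (1 + 1 / t) - 1"

lemma ln_succ_bounds:
  fixes u :: real
  assumes "u > 0"
  shows "1 / (u + 1) \<le> ln (u + 1) - ln u" "ln (u + 1) - ln u \<le> 1 / u"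
proof -
  have "ln (u / (u + 1)) \<le> u / (u + 1) - 1" using assms by (intro ln_le_minus_one) auto
  then show "1 / (u + 1) \<le> ln (u + 1) - ln u"
    using assms by (simp add: ln_div field_simps)
  have "ln ((u + 1) / u) \<le> (u + 1) / u - 1" using assms by (intro ln_le_minus_one) auto
  then show "ln (u + 1) - ln u \<le> 1 / u"
    using assms by (simp add: ln_div field_simps)
qed

text \<open>
  \<open>F\<close> is the antiderivative of \<open>x \<mapsto> ln ((\<alpha> + x) / \<alpha>)\<close> that vanishes at 0, so this is the comparison of
  the integral of an increasing function with its left and right Riemann sums.
\<close>

lemma sum_ln_bounds:
  fixes \<alpha> :: real
  assumes "\<alpha> > 0"
  defines "F \<equiv> \<lambda>N. (\<alpha> + real N) * (ln (\<alpha> + real N) - ln \<alpha>) - real N"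
  shows "(\<Sum>i<N. ln (\<alpha> + real i) - ln \<alpha>) \<le> F N"
    and "F N \<le> (\<Sum>i<N. ln (\<alpha> + real i) - ln \<alpha>) + (ln (\<alpha> + real N) - ln \<alpha>)"
proof -
  have step: "ln (\<alpha> + real n) - ln \<alpha> \<le> F (Suc n) - F n" "F (Suc n) - F n \<le> ln (\<alpha> + real (Suc n)) - ln \<alpha>" for n
  proof -
    define u where "u = \<alpha> + real n"
    have u: "u > 0" using assms by (simp add: u_def)
    have F: "F (Suc n) - F n = (u + 1) * (ln (u + 1) - ln u) + (ln u - ln \<alpha>) - 1"
      "F (Suc n) - F n = u * (ln (u + 1) - ln u) + (ln (u + 1) - ln \<alpha>) - 1"
      by (simp_all add: F_def u_def algebra_simps)
    have "1 \<le> (u + 1) * (ln (u + 1) - ln u)" "u * (ln (u + 1) - ln u) \<le> 1"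
      using ln_succ_bounds[OF u] u by (simp_all add: field_simps)
    then show "ln (\<alpha> + real n) - ln \<alpha> \<le> F (Suc n) - F n" "F (Suc n) - F n \<le> ln (\<alpha> + real (Suc n)) - ln \<alpha>"
      using F by (simp_all add: u_def add_ac)
  qed
  show "(\<Sum>i<N. ln (\<alpha> + real i) - ln \<alpha>) \<le> F N"
  proof (induction N)
    case (Suc n) with step(1)[of n] show ?case by simp
  qed (simp add: F_def)
  show "F N \<le> (\<Sum>i<N. ln (\<alpha> + real i) - ln \<alpha>) + (ln (\<alpha> + real N) - ln \<alpha>)"
  proof (induction N)
    case (Suc n) with step(2)[of n] show ?case by simp
  qed (simp add: F_def)
qed

text \<open>
  The rate is exact up to a factor that is bounded for \<open>t\<close> bounded away from 0.
\<close>

lemma all_distinct_prob_bounds: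
  assumes t: "t > 0" and N: "N > 0"
  shows "exp (- (real N * distinct_rate t)) \<le> all_distinct_prob N (t * real N)"
    and "all_distinct_prob N (t * real N) \<le> (1 + 1 / t) * exp (- (real N * distinct_rate t))"
proof -
  define \<alpha> where "\<alpha> = t * real N"
  have \<alpha>: "\<alpha> > 0" using t N by (simp add: \<alpha>_def)
  define S where "S = (\<Sum>i<N. ln (\<alpha> + real i) - ln \<alpha>)"
  have "all_distinct_prob N \<alpha> = (\<Prod>i<N. exp (- (ln (\<alpha> + real i) - ln \<alpha>)))"
    unfolding all_distinct_prob_def using \<alpha> by (intro prod.cong) (auto simp: exp_diff)
  also have "\<dots> = exp (- S)"
    by (simp add: exp_sum S_def sum_negf[symmetric])
  finally have w: "all_distinct_prob N \<alpha> = exp (- S)" .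
  have quot: "ln (\<alpha> + real N) - ln \<alpha> = ln (1 + 1 / t)"
  proof -
    have "(\<alpha> + real N) / \<alpha> = 1 + 1 / t"
      using t N by (simp add: \<alpha>_def field_simps)
    then show ?thesis using ln_div[of "\<alpha> + real N" \<alpha>] \<alpha> by simp
  qed
  have rate: "(\<alpha> + real N) * (ln (\<alpha> + real N) - ln \<alpha>) - real N = real N * distinct_rate t"
    unfolding quot by (simp add: distinct_rate_def \<alpha>_def algebra_simps)
  show "exp (- (real N * distinct_rate t)) \<le> all_distinct_prob N (t * real N)"
    using sum_ln_bounds(1)[OF \<alpha>, of N] rate w by (simp add: S_def \<alpha>_def)
  have "- S \<le> ln (1 + 1 / t) + - (real N * distinct_rate t)"
    using sum_ln_bounds(2)[OF \<alpha>, of N] rate quot by (simp add: S_def)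
  then have "exp (- S) \<le> exp (ln (1 + 1 / t)) * exp (- (real N * distinct_rate t))"
    by (simp only: exp_add[symmetric] exp_le_cancel_iff)
  then show "all_distinct_prob N (t * real N) \<le> (1 + 1 / t) * exp (- (real N * distinct_rate t))"
    using w t by (simp add: \<alpha>_def add_pos_pos)
qed

text \<open>
  Minus the derivative of the rate; the equation that determines the limit under exponential tails
  says that this slope equals \<open>c\<close>.
\<close>

definition rate_slope :: "real \<Rightarrow> real" where
  "rate_slope t = 1 / t - ln (1 + 1 / t)"

lemma distinct_rate_deriv:
  assumes "t > 0"
  shows "(distinct_rate has_real_derivative - rate_slope t) (at t)"
proof -
  have "1 + 1 / t > 0" using assms by (simp add: add_pos_pos)
  then have "(distinct_rate has_real_derivative
      (ln (1 + 1 / t) + (1 + t) * ((- 1 / t\<^sup>2) / (1 + 1 / t)))) (at t)"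
    unfolding distinct_rate_def using assms
    by (auto intro!: derivative_eq_intros simp: power2_eq_square)
  also have "(1 + t) * ((- 1 / t\<^sup>2) / (1 + 1 / t)) = - (1 / t)"
  proof -
    have "t * (1 + t) \<noteq> 0" using assms by simp
    then have "t + t * t \<noteq> 0" by (simp add: distrib_left)
    with assms show ?thesis by (simp add: field_simps power2_eq_square)
  qed
  finally show ?thesis by (simp add: rate_slope_def)
qed

lemma rate_slope_inverse_deriv:
  fixes x :: real assumes "x > -1"
  shows "((\<lambda>x. x - ln (1 + x)) has_real_derivative x / (1 + x)) (at x)"
  using assms by (auto intro!: derivative_eq_intros simp: field_simps)

lemma x_minus_ln_strict_mono:
  fixes x y :: real assumes "0 \<le> x" "x < y"
  shows "x - ln (1 + x) < y - ln (1 + y)"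
proof -
  have "\<exists>z>x. z < y \<and> (y - ln (1 + y)) - (x - ln (1 + x)) = (y - x) * (z / (1 + z))"
    using assms by (intro MVT2 rate_slope_inverse_deriv) auto
  then obtain z where "z > x" "(y - ln (1 + y)) - (x - ln (1 + x)) = (y - x) * (z / (1 + z))" by blast
  moreover have "(y - x) * (z / (1 + z)) > 0" using assms \<open>z > x\<close> by auto
  ultimately show ?thesis by linarith
qed

lemma rate_slope_strict_antimono:
  assumes "0 < s" "s < t"
  shows "rate_slope t < rate_slope s"
  unfolding rate_slope_def using assms
  by (intro x_minus_ln_strict_mono) (auto simp: frac_less2)

lemma rate_slope_pos:
  assumes "0 < t"
  shows "rate_slope t > 0"
  unfolding rate_slope_def using x_minus_ln_strict_mono[of 0 "1 / t"] assms by simp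

lemma rate_slope_bij:
  assumes "c > 0"
  shows "\<exists>!t::real. t > 0 \<and> rate_slope t = c"
proof (rule ex_ex1I)
  have "\<exists>x\<ge>0. x \<le> 2 * c + 2 \<and> x - ln (1 + x) = c"
  proof (rule IVT')
    have "ln (1 + (2 * c + 2)) \<le> c + 2"
    proof -
      have "1 + (2 * c + 2) \<le> (1 + (c + 2) / 2)\<^sup>2"
        using assms by (simp add: power2_eq_square field_simps)
      also have "\<dots> \<le> (exp ((c + 2) / 2))\<^sup>2"
        using assms by (intro power_mono exp_ge_add_one_self_aux) auto
      also have "\<dots> = exp (c + 2)" by (simp add: power2_eq_square exp_add[symmetric])
      finally have "ln (1 + (2 * c + 2)) \<le> ln (exp (c + 2))"
        using assms by (subst ln_le_cancel_iff) auto
      then show ?thesis by simp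
    qed
    then show "c \<le> (2 * c + 2) - ln (1 + (2 * c + 2))" by simp
  qed (use assms in \<open>auto intro!: continuous_intros\<close>)
  then obtain x where x: "x \<ge> 0" "x - ln (1 + x) = c" by blast
  with assms have "x > 0" by (cases "x = 0") auto
  then show "\<exists>t. t > 0 \<and> rate_slope t = c"
    using x by (intro exI[of _ "1 / x"]) (auto simp: rate_slope_def)
next
  fix s t assume "s > 0 \<and> rate_slope s = c" "t > 0 \<and> rate_slope t = c"
  then show "s = t"
    using rate_slope_strict_antimono[of s t] rate_slope_strict_antimono[of t s]
    by (cases s t rule: linorder_cases) auto
qed

text \<open>
  Convexity of the rate: its derivative \<open>- rate_slope\<close> is increasing.
\<close>

lemma distinct_rate_tangent:
  assumes "s > 0" "t > 0"
  shows "distinct_rate t \<ge> distinct_rate s - rate_slope s * (t - s)"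
proof (cases s t rule: linorder_cases)
  case less
  then have "\<exists>z>s. z < t \<and> distinct_rate t - distinct_rate s = (t - s) * (- rate_slope z)"
    using assms by (intro MVT2 distinct_rate_deriv) auto
  then obtain z where z: "s < z" "distinct_rate t - distinct_rate s = (t - s) * (- rate_slope z)" by blast
  have "(t - s) * rate_slope z \<le> (t - s) * rate_slope s"
    using rate_slope_strict_antimono[OF assms(1) z(1)] less by (intro mult_left_mono) auto
  with z show ?thesis by (simp add: mult.commute)
next
  case greater
  then have "\<exists>z>t. z < s \<and> distinct_rate s - distinct_rate t = (s - t) * (- rate_slope z)"
    using assms by (intro MVT2 distinct_rate_deriv) auto
  then obtain z where z: "t < z" "z < s" "distinct_rate s - distinct_rate t = (s - t) * (- rate_slope z)" by blast
  have "(s - t) * rate_slope s \<le> (s - t) * rate_slope z"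
    using rate_slope_strict_antimono[of z s] z assms greater by (intro mult_left_mono) auto
  with z show ?thesis by (simp add: algebra_simps)
qed simp

lemma distinct_rate_strict_antimono:
  assumes "0 < s" "s < t"
  shows "distinct_rate t < distinct_rate s"
proof -
  have "distinct_rate s \<ge> distinct_rate t - rate_slope t * (s - t)"
    using assms by (intro distinct_rate_tangent) auto
  moreover have "rate_slope t * (s - t) < 0"
    using assms rate_slope_pos[of t] by (intro mult_pos_neg) auto
  ultimately show ?thesis by linarith
qed

lemma distinct_rate_unbounded:
  "\<exists>\<tau>>0. distinct_rate \<tau> \<ge> C"
proof -
  define \<tau> where "\<tau> = exp (- (\<bar>C\<bar> + 1))"
  have \<tau>: "\<tau> > 0" by (simp add: \<tau>_def)
  have "\<bar>C\<bar> + 1 = ln (1 / \<tau>)" by (simp add: \<tau>_def ln_div)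
  also have "\<dots> \<le> ln (1 + 1 / \<tau>)" using \<tau> by (subst ln_le_cancel_iff) (auto simp: add_pos_pos)
  also have "\<dots> \<le> (1 + \<tau>) * ln (1 + 1 / \<tau>)"
    using \<tau> by (intro mult_right_mono[of 1 "1 + \<tau>", simplified]) auto
  finally show ?thesis using \<tau> by (intro exI[of _ \<tau>]) (auto simp: distinct_rate_def)
qed

text \<open>
  A prior of tail \<open>exp (- c * \<alpha>)\<close> contributes \<open>c * t\<close> to the exponential rate at \<open>\<alpha> = t * N\<close>.  The
  total rate is strictly convex with minimum at \<open>t0\<close>.  The linear term \<open>m * t\<close> keeps the posterior
  mass of the unbounded range of \<open>t\<close> under control and absorbs the subexponential error of the prior.
\<close>

lemma tilted_rate_growth:
  assumes t0: "t0 > 0" "rate_slope t0 = c" and \<delta>: "\<delta> > 0"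
  shows "\<exists>m>0. \<exists>\<kappa>>0. \<forall>t>0. \<bar>t - t0\<bar> \<ge> \<delta> \<longrightarrow>
    c * t + distinct_rate t \<ge> c * t0 + distinct_rate t0 + \<kappa> + m * t"
proof -
  define g where "g t = c * t + distinct_rate t" for t
  have tangent: "g t \<ge> g s + (c - rate_slope s) * (t - s)" if "s > 0" "t > 0" for s t
    using distinct_rate_tangent[OF that] by (simp add: g_def algebra_simps)
  define d where "d = min \<delta> (t0 / 2)"
  have d: "d > 0" "d \<le> \<delta>" "d < t0" using t0 \<delta> by (auto simp: d_def)
  define l where "l = t0 - d / 2"
  define r where "r = t0 + d / 2"
  have lr: "l > 0" "l < t0" "t0 < r" "r > 0" using d t0 by (auto simp: l_def r_def)
  have gl: "g l \<ge> g t0" and gr: "g r \<ge> g t0"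
    using tangent[OF t0(1), of l] tangent[OF t0(1), of r] lr t0(2) by auto
  \<comment> \<open>Absolute slopes of \<open>g\<close> at two points strictly between \<open>t0\<close> and the range in question.\<close>
  define ml where "ml = rate_slope l - c"
  define mr where "mr = c - rate_slope r"
  have ml: "ml > 0" and mr: "mr > 0"
    using rate_slope_strict_antimono[of l t0] rate_slope_strict_antimono[of t0 r] lr t0
    by (auto simp: ml_def mr_def)
  define \<gamma> where "\<gamma> = min (ml * (d / 2)) (mr * (d / 2))"
  have \<gamma>: "\<gamma> > 0" "\<gamma> \<le> ml * (d / 2)" "\<gamma> \<le> mr * (d / 2)" using ml mr d by (auto simp: \<gamma>_def)
  \<comment> \<open>Small enough that \<open>\<gamma>\<close> still dominates \<open>m * t\<close> where the linear growth starts.\<close>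
  define m where "m = min mr (\<gamma> / (2 * (t0 + d)))"
  have m: "m > 0" "m \<le> mr" "m * (t0 + d) \<le> \<gamma> / 2"
  proof -
    show "m > 0" "m \<le> mr" using mr \<gamma> t0 d by (auto simp: m_def)
    have "m * (t0 + d) \<le> \<gamma> / (2 * (t0 + d)) * (t0 + d)"
      using t0 d by (intro mult_right_mono) (auto simp: m_def)
    also have "\<dots> = \<gamma> / 2" using t0 d by (simp add: field_simps)
    finally show "m * (t0 + d) \<le> \<gamma> / 2" .
  qed
  have "g t \<ge> g t0 + \<gamma> / 2 + m * t" if t: "t > 0" "\<bar>t - t0\<bar> \<ge> \<delta>" for t
  proof (cases "t > t0")
    case True
    then have "t \<ge> t0 + d" using t d by linarith
    have "g t \<ge> g r + mr * (t - r)" using tangent[OF lr(4) t(1)] by (simp add: mr_def)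
    moreover have "mr * (t - r) = mr * (d / 2) + mr * (t - (t0 + d))"
      by (simp add: r_def algebra_simps)
    moreover have "mr * (t - (t0 + d)) \<ge> m * (t - (t0 + d))"
      using m \<open>t \<ge> t0 + d\<close> by (intro mult_right_mono) auto
    moreover have "m * (t - (t0 + d)) = m * t - m * (t0 + d)" by (simp add: algebra_simps)
    ultimately show ?thesis using gr m(3) \<gamma>(3) by linarith
  next
    case False
    then have le: "t \<le> t0 - d" using t d by linarith
    have "g t \<ge> g l + ml * (l - t)" using tangent[OF lr(1) t(1)] by (simp add: ml_def algebra_simps)
    moreover have "ml * (l - t) \<ge> ml * (d / 2)"
      using le ml by (intro mult_left_mono) (auto simp: l_def)
    moreover have "m * t \<le> m * (t0 + d)"
      using le d m by (intro mult_left_mono) auto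
    ultimately show ?thesis using gl m(3) \<gamma>(2) by linarith
  qed
  then show ?thesis
    using m(1) \<gamma>(1) unfolding g_def
    by (intro exI[of _ m] conjI exI[of _ "\<gamma> / 2"] allI impI) auto
qed

section \<open>Concentration of the posterior of the concentration parameter\<close>

text \<open>
  The numerator of the posterior probability that \<open>\<alpha> \<in> S\<close>, given \<open>N\<close> distinct observations.
\<close>

definition joint_mass :: "(real \<Rightarrow> real) \<Rightarrow> nat \<Rightarrow> real set \<Rightarrow> ennreal" where
  "joint_mass pa N S = (\<integral>\<^sup>+\<alpha>\<in>{0<..} \<inter> S. ennreal (pa \<alpha> * all_distinct_prob N \<alpha>) \<partial>lborel)"

lemma joint_mass_mono:
  "(\<And>\<alpha>. \<alpha> > 0 \<Longrightarrow> \<alpha> \<in> S \<Longrightarrow> \<alpha> \<in> T) \<Longrightarrow> joint_mass pa N S \<le> joint_mass pa N T"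
  unfolding joint_mass_def by (intro nn_set_integral_set_mono) auto

lemma nn_integral_exp_tail:
  fixes k c :: real
  assumes "k > 0"
  shows "(\<integral>\<^sup>+x\<in>{c..}. ennreal (exp (- k * x)) \<partial>lborel) = ennreal (exp (- k * c) / k)"
  using nn_integral_has_integral_lebesgue[OF _ has_integral_exp_minus_to_infinity[OF assms, of c]]
  by (simp only: nn_integral_set_ennreal) (simp add: mult.commute)

locale prior_density =
  fixes pa :: "real \<Rightarrow> real"
  assumes pa_measurable [measurable]: "pa \<in> borel_measurable borel"
    and pa_nonneg: "\<And>\<alpha>. \<alpha> > 0 \<Longrightarrow> 0 \<le> pa \<alpha>"
    and pa_integral: "(\<integral>\<^sup>+\<alpha>\<in>{0<..}. ennreal (pa \<alpha>) \<partial>lborel) = 1"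
begin

lemma joint_mass_Un_le:
  assumes [measurable]: "S \<in> sets borel" "T \<in> sets borel"
  shows "joint_mass pa N (S \<union> T) \<le> joint_mass pa N S + joint_mass pa N T"
proof -
  have "joint_mass pa N (S \<union> T) \<le>
      (\<integral>\<^sup>+\<alpha>. ennreal (pa \<alpha> * all_distinct_prob N \<alpha>) * indicator ({0<..} \<inter> S) \<alpha>
        + ennreal (pa \<alpha> * all_distinct_prob N \<alpha>) * indicator ({0<..} \<inter> T) \<alpha> \<partial>lborel)"
    unfolding joint_mass_def by (intro nn_integral_mono) (auto simp: indicator_def)
  also have "\<dots> = joint_mass pa N S + joint_mass pa N T"
    unfolding joint_mass_def by (rule nn_integral_add) measurable
  finally show ?thesis .
qed

lemma joint_mass_le_lower_region:
  assumes "\<alpha>0 > 0"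
  shows "joint_mass pa N {..\<alpha>0} \<le> ennreal (all_distinct_prob N \<alpha>0)"
proof -
  have "joint_mass pa N {..\<alpha>0} \<le>
      (\<integral>\<^sup>+\<alpha>. ennreal (all_distinct_prob N \<alpha>0) * (ennreal (pa \<alpha>) * indicator {0<..} \<alpha>) \<partial>lborel)"
    unfolding joint_mass_def
  proof (intro nn_integral_mono)
    fix \<alpha>
    show "ennreal (pa \<alpha> * all_distinct_prob N \<alpha>) * indicator ({0<..} \<inter> {..\<alpha>0}) \<alpha>
        \<le> ennreal (all_distinct_prob N \<alpha>0) * (ennreal (pa \<alpha>) * indicator {0<..} \<alpha>)"
    proof (cases "0 < \<alpha> \<and> \<alpha> \<le> \<alpha>0")
      case True
      then have "pa \<alpha> * all_distinct_prob N \<alpha> \<le> all_distinct_prob N \<alpha>0 * pa \<alpha>"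
        using pa_nonneg all_distinct_prob_mono[of \<alpha> \<alpha>0 N]
        by (subst mult.commute) (intro mult_right_mono; simp)
      then show ?thesis
        using True pa_nonneg[of \<alpha>] all_distinct_prob_pos[OF assms, of N]
        by (simp add: ennreal_mult[symmetric] ennreal_leI)
    qed (auto simp: indicator_def)
  qed
  also have "\<dots> = ennreal (all_distinct_prob N \<alpha>0)"
    by (subst nn_integral_cmult) (auto simp: pa_integral)
  finally show ?thesis .
qed

lemma joint_mass_ge_interval:
  assumes ab: "0 < a" "a \<le> b" and p: "p \<ge> 0" "\<And>\<alpha>. a \<le> \<alpha> \<Longrightarrow> \<alpha> \<le> b \<Longrightarrow> pa \<alpha> \<ge> p"
  shows "joint_mass pa N UNIV \<ge> ennreal ((b - a) * p * all_distinct_prob N a)"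
proof -
  have w: "all_distinct_prob N a > 0" using ab by (intro all_distinct_prob_pos)
  have "ennreal ((b - a) * p * all_distinct_prob N a)
      = ennreal (p * all_distinct_prob N a) * emeasure lborel {a..b}"
    using ab p w by (simp add: ennreal_mult[symmetric] mult_ac)
  also have "\<dots> = (\<integral>\<^sup>+\<alpha>. ennreal (p * all_distinct_prob N a) * indicator {a..b} \<alpha> \<partial>lborel)"
    by (rule nn_integral_cmult_indicator[symmetric]) simp
  also have "\<dots> \<le> joint_mass pa N UNIV"
    unfolding joint_mass_def
  proof (intro nn_integral_mono)
    fix \<alpha>
    show "ennreal (p * all_distinct_prob N a) * indicator {a..b} \<alpha>
        \<le> ennreal (pa \<alpha> * all_distinct_prob N \<alpha>) * indicator ({0<..} \<inter> UNIV) \<alpha>"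
    proof (cases "a \<le> \<alpha> \<and> \<alpha> \<le> b")
      case True
      then have "p * all_distinct_prob N a \<le> pa \<alpha> * all_distinct_prob N \<alpha>"
        using p w ab all_distinct_prob_mono[of a \<alpha> N] by (intro mult_mono) (auto intro: order.trans)
      then show ?thesis using True ab by (simp add: ennreal_leI)
    qed (auto simp: indicator_def)
  qed
  finally show ?thesis .
qed

end

lemma tendsto_0_of_ratio_bound:
  fixes X Z :: "nat \<Rightarrow> ennreal" and a b :: "nat \<Rightarrow> real"
  assumes "\<forall>\<^sub>F N in sequentially. X N \<le> ennreal (a N) \<and> ennreal (b N) \<le> Z N \<and> b N > 0 \<and> a N \<ge> 0 \<and> a N / b N \<le> q N"
    and "q \<longlonglongrightarrow> 0"
  shows "(\<lambda>N. X N / Z N) \<longlonglongrightarrow> 0"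
proof (rule tendsto_sandwich[of "\<lambda>_. 0"])
  show "\<forall>\<^sub>F N in sequentially. X N / Z N \<le> ennreal (q N)"
    using assms(1)
  proof eventually_elim
    case (elim N)
    have "inverse (Z N) \<le> inverse (ennreal (b N))"
      using elim by (cases "Z N" rule: ennreal_cases) (auto simp: inverse_ennreal intro!: ennreal_leI le_imp_inverse_le)
    then have "X N / Z N \<le> ennreal (a N) / ennreal (b N)"
      unfolding divide_ennreal_def using elim by (intro mult_mono) auto
    also have "\<dots> = ennreal (a N / b N)" using elim by (intro divide_ennreal) auto
    also have "\<dots> \<le> ennreal (q N)" using elim by (intro ennreal_leI) auto
    finally show ?case .
  qed
  show "(\<lambda>N. ennreal (q N)) \<longlonglongrightarrow> 0"
    using tendsto_ennrealI[OF assms(2)] by simp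
qed auto

lemma exp_neg_mult_tendsto_0:
  fixes k C :: real assumes "k > 0"
  shows "(\<lambda>N. C * exp (- (k * real N))) \<longlonglongrightarrow> 0"
proof -
  have "(\<lambda>N. exp (- k) ^ N) \<longlonglongrightarrow> 0"
    using assms by (intro LIMSEQ_realpow_zero) auto
  then have "(\<lambda>N. C * exp (- k) ^ N) \<longlonglongrightarrow> C * 0" by (rule tendsto_mult_left)
  then show ?thesis by (simp add: exp_of_nat_mult[symmetric] mult.commute)
qed

text \<open>
  For \<open>c = 0\<close> this is the heavy tail, for \<open>c > 0\<close> the exponential tail.
\<close>

lemma tail_density_bounds:
  assumes "((\<lambda>\<alpha>. neg_log_density pa \<alpha> / ereal \<alpha>) \<longlongrightarrow> ereal c) at_top" "\<eta> > 0"
  shows "\<exists>\<alpha>0>0. \<forall>\<alpha>\<ge>\<alpha>0. exp (- (c + \<eta>) * \<alpha>) \<le> pa \<alpha> \<and> pa \<alpha> \<le> exp (- (c - \<eta>) * \<alpha>)"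
proof -
  have "\<forall>\<^sub>F \<alpha> in at_top. neg_log_density pa \<alpha> / ereal \<alpha> < ereal (c + \<eta>)"
    "\<forall>\<^sub>F \<alpha> in at_top. neg_log_density pa \<alpha> / ereal \<alpha> > ereal (c - \<eta>)"
    using assms by (auto intro!: order_tendstoD[OF assms(1)])
  with eventually_gt_at_top[of 0]
  have "\<forall>\<^sub>F \<alpha> in at_top. \<alpha> > 0 \<and> exp (- (c + \<eta>) * \<alpha>) \<le> pa \<alpha> \<and> pa \<alpha> \<le> exp (- (c - \<eta>) * \<alpha>)"
  proof eventually_elim
    case (elim \<alpha>)
    then have pos: "pa \<alpha> > 0" by (auto simp: neg_log_density_def split: if_splits)
    with elim have "- ln (pa \<alpha>) / \<alpha> < c + \<eta>" "- ln (pa \<alpha>) / \<alpha> > c - \<eta>"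
      by (auto simp: neg_log_density_def)
    then have "- ln (pa \<alpha>) < (c + \<eta>) * \<alpha>" "(c - \<eta>) * \<alpha> < - ln (pa \<alpha>)"
      using elim(1) by (simp_all only: pos_divide_less_eq pos_less_divide_eq)
    then have "- (c + \<eta>) * \<alpha> \<le> ln (pa \<alpha>)" "ln (pa \<alpha>) \<le> - (c - \<eta>) * \<alpha>"
      unfolding mult_minus_left by linarith+
    then show ?case using pos elim by (simp add: ln_ge_iff) (metis exp_le_cancel_iff exp_ln)
  qed
  then show ?thesis
    by (auto simp: eventually_at_top_linorder)
qed

text \<open>
  The weight of \<open>H\<close> in the posterior base distribution is \<open>\<alpha> / (\<alpha> + N)\<close>.  Unlike \<open>t = \<alpha> / N\<close>, it
  has a finite limit in all three tail regimes, namely \<open>t / (1 + t)\<close>, to be read as 1 at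
  \<open>t = \<infinity>\<close>.
\<close>

definition prior_weight_concentrates :: "(real \<Rightarrow> real) \<Rightarrow> real \<Rightarrow> bool" where
  "prior_weight_concentrates pa u \<longleftrightarrow>
     (\<forall>\<delta>>0. (\<lambda>N. joint_mass pa N {\<alpha>. \<bar>\<alpha> / (\<alpha> + real N) - u\<bar> \<ge> \<delta>} / joint_mass pa N UNIV) \<longlonglongrightarrow> 0)"

context prior_density
begin

text \<open>
  For \<open>\<alpha> \<le> R * N\<close> the likelihood is at most of order \<open>exp (- N * distinct_rate R)\<close>.  It is
  exponentially larger on the unit interval that starts at \<open>2 * R * N\<close>, and the prior of that interval
  is only subexponentially small.
\<close>

lemma heavy_tail_concentrates:
  assumes "heavy_tail pa"
  shows "prior_weight_concentrates pa 1"
  unfolding prior_weight_concentrates_def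
proof (intro allI impI)
  fix \<delta> :: real assume \<delta>: "\<delta> > 0"
  \<comment> \<open>The weight differs from 1 by at least \<open>\<delta>\<close> only if \<open>\<alpha> \<le> R * N\<close>.\<close>
  define R where "R = 1 / \<delta>"
  have R: "R > 0" using \<delta> by (simp add: R_def)
  define gap where "gap = distinct_rate R - distinct_rate (2 * R)"
  have gap: "gap > 0" using distinct_rate_strict_antimono[of R "2 * R"] R by (simp add: gap_def)
  \<comment> \<open>The prior then costs at most half of the gap at \<open>\<alpha> = 2 * R * N\<close>.\<close>
  define \<eta> where "\<eta> = gap / (4 * R)"
  have \<eta>: "\<eta> > 0" using gap R by (simp add: \<eta>_def)
  have "((\<lambda>\<alpha>. neg_log_density pa \<alpha> / ereal \<alpha>) \<longlongrightarrow> ereal 0) at_top"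
    using assms by (simp add: heavy_tail_def zero_ereal_def)
  from tail_density_bounds[OF this \<eta>]
  obtain \<alpha>0 where \<alpha>0: "\<alpha>0 > 0" "\<And>\<alpha>. \<alpha> \<ge> \<alpha>0 \<Longrightarrow> exp (- \<eta> * \<alpha>) \<le> pa \<alpha>" by auto
  define a where "a N = (1 + 1 / R) * exp (- (real N * distinct_rate R))" for N :: nat
  define b where "b N = 1 * exp (- \<eta> * (2 * R * real N + 1)) * exp (- (real N * distinct_rate (2 * R)))" for N :: nat
  show "(\<lambda>N. joint_mass pa N {\<alpha>. \<bar>\<alpha> / (\<alpha> + real N) - 1\<bar> \<ge> \<delta>} / joint_mass pa N UNIV) \<longlonglongrightarrow> 0"
  proof (rule tendsto_0_of_ratio_bound)
    show "(\<lambda>N. (1 + 1 / R) * exp \<eta> * exp (- (gap / 2 * real N))) \<longlonglongrightarrow> 0"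
      using gap by (intro exp_neg_mult_tendsto_0) simp
    have "\<forall>\<^sub>F N in sequentially. \<alpha>0 / (2 * R) \<le> real N"
      by (rule eventually_ge_at_top[THEN filterlim_real_sequentially[unfolded filterlim_iff, rule_format]])
    with eventually_gt_at_top[of 0]
    show "\<forall>\<^sub>F N in sequentially.
        joint_mass pa N {\<alpha>. \<bar>\<alpha> / (\<alpha> + real N) - 1\<bar> \<ge> \<delta>} \<le> ennreal (a N) \<and>
        ennreal (b N) \<le> joint_mass pa N UNIV \<and> b N > 0 \<and> a N \<ge> 0 \<and>
        a N / b N \<le> (1 + 1 / R) * exp \<eta> * exp (- (gap / 2 * real N))"
    proof eventually_elim
      case (elim N)
      have RN: "R * real N > 0" using R elim by simp
      have ge: "2 * R * real N \<ge> \<alpha>0" using elim R by (simp add: field_simps)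
      have "joint_mass pa N {\<alpha>. \<bar>\<alpha> / (\<alpha> + real N) - 1\<bar> \<ge> \<delta>} \<le> joint_mass pa N {..R * real N}"
      proof (rule joint_mass_mono)
        fix \<alpha> assume \<alpha>: "\<alpha> > 0" "\<alpha> \<in> {\<alpha>. \<bar>\<alpha> / (\<alpha> + real N) - 1\<bar> \<ge> \<delta>}"
        have "\<alpha> / (\<alpha> + real N) - 1 = - (real N / (\<alpha> + real N))"
          using \<alpha>(1) by (simp add: field_simps)
        with \<alpha> have "\<delta> \<le> real N / (\<alpha> + real N)" by simp
        then have "\<delta> * (\<alpha> + real N) \<le> real N" using \<alpha>(1) by (simp add: pos_le_divide_eq)
        moreover have "\<delta> * \<alpha> \<le> \<delta> * (\<alpha> + real N)" using \<delta> by (intro mult_left_mono) auto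
        ultimately have "\<delta> * \<alpha> \<le> real N" by linarith
        then show "\<alpha> \<in> {..R * real N}" using \<delta> by (simp add: R_def field_simps)
      qed
      also have "\<dots> \<le> ennreal (all_distinct_prob N (R * real N))"
        by (rule joint_mass_le_lower_region[OF RN])
      also have "\<dots> \<le> ennreal (a N)"
        unfolding a_def using all_distinct_prob_bounds(2)[OF R elim(1)] by (rule ennreal_leI)
      finally have 1: "joint_mass pa N {\<alpha>. \<bar>\<alpha> / (\<alpha> + real N) - 1\<bar> \<ge> \<delta>} \<le> ennreal (a N)" .
      have "b N \<le> ((2 * R * real N + 1) - 2 * R * real N) * exp (- \<eta> * (2 * R * real N + 1))
          * all_distinct_prob N (2 * R * real N)"
        unfolding b_def using R all_distinct_prob_bounds(1)[of "2 * R" N] elim(1) by simp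
      also have "ennreal \<dots> \<le> joint_mass pa N UNIV"
      proof (rule joint_mass_ge_interval)
        fix \<alpha> assume "2 * R * real N \<le> \<alpha>" "\<alpha> \<le> 2 * R * real N + 1"
        then have "exp (- \<eta> * (2 * R * real N + 1)) \<le> exp (- \<eta> * \<alpha>)" "exp (- \<eta> * \<alpha>) \<le> pa \<alpha>"
          using \<eta> \<alpha>0(2) ge by (auto intro: order.trans)
        then show "exp (- \<eta> * (2 * R * real N + 1)) \<le> pa \<alpha>" by linarith
      qed (use RN in auto)
      finally have 2: "ennreal (b N) \<le> joint_mass pa N UNIV" by (simp add: ennreal_leI)
      have "a N / b N = (1 + 1 / R) * exp (- (real N * distinct_rate R) - (- \<eta> * (2 * R * real N + 1) + - (real N * distinct_rate (2 * R))))"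
        unfolding a_def b_def by (simp only: exp_diff exp_add mult_1 times_divide_eq_right)
      also have "- (real N * distinct_rate R) - (- \<eta> * (2 * R * real N + 1) + - (real N * distinct_rate (2 * R)))
          = \<eta> + - (gap / 2 * real N)"
        using R by (simp add: \<eta>_def gap_def field_simps)
      finally have 3: "a N / b N = (1 + 1 / R) * exp \<eta> * exp (- (gap / 2 * real N))"
        by (simp only: exp_add mult.assoc)
      from 1 2 3 R show ?case by (simp add: a_def b_def)
    qed
  qed
qed

text \<open>
  Laplace's method.  The evidence is bounded below by a unit interval that starts at \<open>t0 * N\<close>.  The range
  away from \<open>t0\<close> is split at \<open>\<tau> * N\<close>: above, the prior is governed by its tail and the growth of the
  tilted rate applies; below, nothing is known about the prior except its total mass, but for small
  \<open>\<tau>\<close> the likelihood alone is small enough.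
\<close>

lemma exponential_tail_concentrates:
  assumes tail: "exponential_tail pa c" and t0: "t0 > 0" "rate_slope t0 = c"
  shows "prior_weight_concentrates pa (t0 / (1 + t0))"
  unfolding prior_weight_concentrates_def
proof (intro allI impI)
  fix \<delta> :: real assume \<delta>: "\<delta> > 0"
  obtain m \<kappa> where m: "m > 0" and \<kappa>: "\<kappa> > 0"
    and growth: "\<And>t. t > 0 \<Longrightarrow> \<bar>t - t0\<bar> \<ge> \<delta> \<Longrightarrow>
      c * t + distinct_rate t \<ge> c * t0 + distinct_rate t0 + \<kappa> + m * t"
    using tilted_rate_growth[OF t0 \<delta>] by blast
  define g where "g = c * t0 + distinct_rate t0"
  \<comment> \<open>Dominated by the linear growth \<open>m\<close> in the numerator and by \<open>\<kappa>\<close> in the evidence.\<close>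
  define \<eta> where "\<eta> = min (m / 2) (\<kappa> / (2 * t0))"
  have \<eta>: "\<eta> > 0" "\<eta> \<le> m / 2" "\<eta> * t0 \<le> \<kappa> / 2"
  proof -
    show "\<eta> > 0" "\<eta> \<le> m / 2" using m \<kappa> t0 by (auto simp: \<eta>_def)
    have "\<eta> * t0 \<le> \<kappa> / (2 * t0) * t0" using t0 by (intro mult_right_mono) (auto simp: \<eta>_def)
    then show "\<eta> * t0 \<le> \<kappa> / 2" using t0 by simp
  qed
  from tail have c: "c > 0" and "((\<lambda>\<alpha>. neg_log_density pa \<alpha> / ereal \<alpha>) \<longlongrightarrow> ereal c) at_top"
    by (auto simp: exponential_tail_def)
  from tail_density_bounds[OF this(2) \<eta>(1)]
  obtain \<alpha>0 where \<alpha>0: "\<alpha>0 > 0" "\<And>\<alpha>. \<alpha> \<ge> \<alpha>0 \<Longrightarrow> exp (- (c + \<eta>) * \<alpha>) \<le> pa \<alpha>"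
    "\<And>\<alpha>. \<alpha> \<ge> \<alpha>0 \<Longrightarrow> pa \<alpha> \<le> exp (- (c - \<eta>) * \<alpha>)" by auto
  obtain \<tau> where \<tau>: "\<tau> > 0" "distinct_rate \<tau> \<ge> g + \<kappa>"
    using distinct_rate_unbounded by blast
  define K where "K = (1 + 1 / \<tau>) * (1 + 2 / m)"
  have K: "K > 0" using \<tau> m by (simp add: K_def add_pos_pos)
  define a where "a N = K * exp (- (real N * (g + \<kappa>)))" for N :: nat
  define b where "b N = 1 * exp (- (c + \<eta>) * (t0 * real N + 1)) * exp (- (real N * distinct_rate t0))" for N :: nat
  show "(\<lambda>N. joint_mass pa N {\<alpha>. \<bar>\<alpha> / (\<alpha> + real N) - t0 / (1 + t0)\<bar> \<ge> \<delta>} / joint_mass pa N UNIV) \<longlonglongrightarrow> 0"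
  proof (rule tendsto_0_of_ratio_bound)
    show "(\<lambda>N. K * exp (c + \<eta>) * exp (- (\<kappa> / 2 * real N))) \<longlonglongrightarrow> 0"
      using \<kappa> by (intro exp_neg_mult_tendsto_0) simp
    have "\<forall>\<^sub>F N in sequentially. max (\<alpha>0 / \<tau>) (\<alpha>0 / t0) \<le> real N"
      by (rule eventually_ge_at_top[THEN filterlim_real_sequentially[unfolded filterlim_iff, rule_format]])
    with eventually_gt_at_top[of 0]
    show "\<forall>\<^sub>F N in sequentially.
        joint_mass pa N {\<alpha>. \<bar>\<alpha> / (\<alpha> + real N) - t0 / (1 + t0)\<bar> \<ge> \<delta>} \<le> ennreal (a N) \<and>
        ennreal (b N) \<le> joint_mass pa N UNIV \<and> b N > 0 \<and> a N \<ge> 0 \<and>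
        a N / b N \<le> K * exp (c + \<eta>) * exp (- (\<kappa> / 2 * real N))"
    proof eventually_elim
      case (elim N)
      have \<tau>N: "\<tau> * real N > 0" "\<tau> * real N \<ge> \<alpha>0" and t0N: "t0 * real N > 0" "t0 * real N \<ge> \<alpha>0"
        using elim \<tau> t0 by (auto simp: field_simps)
      define E where "E = exp (- (real N * (g + \<kappa>)))"
      define T where "T = {\<alpha>. \<tau> * real N \<le> \<alpha> \<and> \<bar>\<alpha> / real N - t0\<bar> \<ge> \<delta>}"
      have [measurable]: "T \<in> sets borel" unfolding T_def by measurable
      have "joint_mass pa N {\<alpha>. \<bar>\<alpha> / (\<alpha> + real N) - t0 / (1 + t0)\<bar> \<ge> \<delta>}
          \<le> joint_mass pa N ({..\<tau> * real N} \<union> T)"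
      proof (rule joint_mass_mono)
        fix \<alpha> assume \<alpha>: "\<alpha> > 0" "\<alpha> \<in> {\<alpha>. \<bar>\<alpha> / (\<alpha> + real N) - t0 / (1 + t0)\<bar> \<ge> \<delta>}"
        define t where "t = \<alpha> / real N"
        have t: "t > 0" "\<alpha> = t * real N" using \<alpha> elim by (auto simp: t_def)
        have "\<alpha> / (\<alpha> + real N) = (t * real N) / ((1 + t) * real N)"
          by (simp add: t(2) algebra_simps)
        also have "\<dots> = t / (1 + t)" using elim by simp
        finally have "\<alpha> / (\<alpha> + real N) - t0 / (1 + t0) = (t - t0) / ((1 + t) * (1 + t0))"
          using t t0 by (simp add: diff_frac_eq algebra_simps)
        then have "\<delta> \<le> \<bar>t - t0\<bar> / ((1 + t) * (1 + t0))"
          using \<alpha>(2) t t0 by (simp add: abs_divide abs_mult)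
        also have "\<dots> \<le> \<bar>t - t0\<bar> / 1"
        proof (rule divide_left_mono)
          have "1 * 1 \<le> (1 + t) * (1 + t0)" using t t0 by (intro mult_mono) auto
          then show "1 \<le> (1 + t) * (1 + t0)" by simp
        qed (use t t0 in auto)
        finally show "\<alpha> \<in> {..\<tau> * real N} \<union> T" by (auto simp: T_def t_def)
      qed
      also have "\<dots> \<le> joint_mass pa N {..\<tau> * real N} + joint_mass pa N T"
        by (rule joint_mass_Un_le) auto
      also have "joint_mass pa N {..\<tau> * real N} \<le> ennreal ((1 + 1 / \<tau>) * E)"
      proof (rule order.trans[OF joint_mass_le_lower_region[OF \<tau>N(1)]], rule ennreal_leI)
        have "all_distinct_prob N (\<tau> * real N) \<le> (1 + 1 / \<tau>) * exp (- (real N * distinct_rate \<tau>))"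
          by (rule all_distinct_prob_bounds(2)[OF \<tau>(1) elim(1)])
        also have "\<dots> \<le> (1 + 1 / \<tau>) * E"
          unfolding E_def using \<tau> by (intro mult_left_mono) (auto intro: mult_left_mono)
        finally show "all_distinct_prob N (\<tau> * real N) \<le> (1 + 1 / \<tau>) * E" .
      qed
      also have "joint_mass pa N T \<le> ennreal ((1 + 1 / \<tau>) * E * (2 / m))"
      proof -
        have "joint_mass pa N T \<le>
            (\<integral>\<^sup>+\<alpha>. ennreal ((1 + 1 / \<tau>) * E) * (ennreal (exp (- (m / 2) * \<alpha>)) * indicator {0..} \<alpha>) \<partial>lborel)"
          unfolding joint_mass_def
        proof (intro nn_integral_mono)
          fix \<alpha>
          show "ennreal (pa \<alpha> * all_distinct_prob N \<alpha>) * indicator ({0<..} \<inter> T) \<alpha>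
            \<le> ennreal ((1 + 1 / \<tau>) * E) * (ennreal (exp (- (m / 2) * \<alpha>)) * indicator {0..} \<alpha>)"
          proof (cases "0 < \<alpha> \<and> \<alpha> \<in> T")
            case True
            define t where "t = \<alpha> / real N"
            have t: "t > 0" "\<alpha> = t * real N" "\<tau> \<le> t" "\<bar>t - t0\<bar> \<ge> \<delta>"
              using True elim by (auto simp: t_def T_def field_simps)
            have \<alpha>: "\<alpha> \<ge> \<alpha>0" using True \<tau>N by (auto simp: T_def)
            have "all_distinct_prob N \<alpha> \<le> (1 + 1 / t) * exp (- (real N * distinct_rate t))"
              using all_distinct_prob_bounds(2)[OF t(1) elim(1)] t(2) by simp
            also have "\<dots> \<le> (1 + 1 / \<tau>) * exp (- (real N * distinct_rate t))"
              using t \<tau> by (intro mult_right_mono) (auto simp: frac_le)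
            finally have "pa \<alpha> * all_distinct_prob N \<alpha>
                \<le> exp (- (c - \<eta>) * \<alpha>) * ((1 + 1 / \<tau>) * exp (- (real N * distinct_rate t)))"
              using \<alpha>0(3)[OF \<alpha>] all_distinct_prob_pos[of \<alpha> N] True
              by (intro mult_mono) auto
            also have "\<dots> = (1 + 1 / \<tau>) * exp (- (c - \<eta>) * \<alpha> + - (real N * distinct_rate t))"
              by (simp only: exp_add mult_ac)
            also have "\<dots> \<le> (1 + 1 / \<tau>) * exp (- (real N * (g + \<kappa>)) + - (m / 2) * \<alpha>)"
            proof -
              have "real N * (g + \<kappa> + m * t) \<le> real N * (c * t + distinct_rate t)"
                using growth[OF t(1,4)] by (intro mult_left_mono) (auto simp: g_def)
              then have "real N * (g + \<kappa>) + m * \<alpha> \<le> c * \<alpha> + real N * distinct_rate t"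
                by (simp add: t(2) algebra_simps)
              moreover have "\<eta> * \<alpha> \<le> m / 2 * \<alpha>" using \<eta>(2) True by (intro mult_right_mono) auto
              ultimately have "- (c - \<eta>) * \<alpha> + - (real N * distinct_rate t)
                  \<le> - (real N * (g + \<kappa>)) + - (m / 2) * \<alpha>"
                by (simp add: algebra_simps)
              then show ?thesis using \<tau> by (intro mult_left_mono) auto
            qed
            also have "\<dots> = (1 + 1 / \<tau>) * E * exp (- (m / 2) * \<alpha>)"
              by (simp only: exp_add E_def mult.assoc)
            finally show ?thesis
              using True \<tau> by (simp add: ennreal_mult[symmetric] E_def ennreal_leI)
          qed (auto simp: indicator_def)
        qed
        also have "\<dots> = ennreal ((1 + 1 / \<tau>) * E) * ennreal (exp (- (m / 2) * 0) / (m / 2))"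
          by (subst nn_integral_cmult) (use m in \<open>simp_all only: nn_integral_exp_tail half_gt_zero, measurable\<close>)
        also have "\<dots> = ennreal ((1 + 1 / \<tau>) * E * (2 / m))"
          using \<tau> m by (simp add: ennreal_mult[symmetric] E_def)
        finally show ?thesis .
      qed
      also have "ennreal ((1 + 1 / \<tau>) * E) + ennreal ((1 + 1 / \<tau>) * E * (2 / m)) = ennreal (a N)"
        using \<tau> m by (subst ennreal_plus[symmetric]) (auto simp: a_def K_def E_def distrib_left mult_ac)
      finally have 1: "joint_mass pa N {\<alpha>. \<bar>\<alpha> / (\<alpha> + real N) - t0 / (1 + t0)\<bar> \<ge> \<delta>} \<le> ennreal (a N)"
        by (meson add_mono order.refl order.trans)
      have "b N \<le> ((t0 * real N + 1) - t0 * real N) * exp (- (c + \<eta>) * (t0 * real N + 1))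
          * all_distinct_prob N (t0 * real N)"
        unfolding b_def using all_distinct_prob_bounds(1)[OF t0(1) elim(1)] by simp
      also have "ennreal \<dots> \<le> joint_mass pa N UNIV"
      proof (rule joint_mass_ge_interval)
        fix \<alpha> assume \<alpha>: "t0 * real N \<le> \<alpha>" "\<alpha> \<le> t0 * real N + 1"
        have "exp (- (c + \<eta>) * (t0 * real N + 1)) \<le> exp (- (c + \<eta>) * \<alpha>)"
          using \<eta> c \<alpha>(2) by simp
        also have "\<dots> \<le> pa \<alpha>" using \<alpha>0(2) \<alpha> t0N by simp
        finally show "exp (- (c + \<eta>) * (t0 * real N + 1)) \<le> pa \<alpha>" .
      qed (use t0N in auto)
      finally have 2: "ennreal (b N) \<le> joint_mass pa N UNIV" by (simp add: ennreal_leI)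
      have "a N / b N = K * exp (- (real N * (g + \<kappa>)) - (- (c + \<eta>) * (t0 * real N + 1) + - (real N * distinct_rate t0)))"
        unfolding a_def b_def by (simp only: exp_diff exp_add mult_1 times_divide_eq_right)
      also have "- (real N * (g + \<kappa>)) - (- (c + \<eta>) * (t0 * real N + 1) + - (real N * distinct_rate t0))
          = (c + \<eta>) + - ((\<kappa> - \<eta> * t0) * real N)"
        by (simp add: g_def algebra_simps)
      also have "K * exp \<dots> \<le> K * exp ((c + \<eta>) + - (\<kappa> / 2 * real N))"
      proof -
        have "\<kappa> / 2 * real N \<le> (\<kappa> - \<eta> * t0) * real N" using \<eta>(3) by (intro mult_right_mono) auto
        then show ?thesis using K by (intro mult_left_mono) auto
      qed
      finally have 3: "a N / b N \<le> K * exp (c + \<eta>) * exp (- (\<kappa> / 2 * real N))"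
        by (simp only: exp_add mult.assoc)
      from 1 2 3 K show ?case by (simp add: a_def b_def)
    qed
  qed
qed

end

text \<open>
  Superlinear growth of \<open>V\<close> alone would allow a density with long gaps.  Log-concavity excludes them:
  since the slope of a chord of \<open>- ln pa\<close> from a fixed point \<open>x1\<close> exceeds \<open>K\<close> eventually, so do, by
  convexity, the slopes of all chords further out.
\<close>

lemma log_concave_superlinear_decay:
  assumes lc: "log_concave_on {B<..} pa" and B: "B > 0" and nonneg: "\<And>\<alpha>. \<alpha> > 0 \<Longrightarrow> pa \<alpha> \<ge> 0"
    and unb: "\<not> bounded {\<alpha>. \<alpha> > 0 \<and> pa \<alpha> \<noteq> 0}"
    and lim: "((\<lambda>\<alpha>. neg_log_density pa \<alpha> / ereal \<alpha>) \<longlongrightarrow> \<infinity>) at_top" and K: "K > 0"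
  shows "\<exists>y0>0. \<forall>y\<ge>y0. pa y > 0 \<and> (\<forall>s\<ge>0. pa (y + s) \<le> pa y * exp (- K * s))"
proof -
  have beyond: "\<exists>z>x. pa z > 0" if "x > 0" for x
  proof (rule ccontr)
    assume "\<nexists>z. z > x \<and> pa z > 0"
    then have "{\<alpha>. \<alpha> > 0 \<and> pa \<alpha> \<noteq> 0} \<subseteq> {0..x}"
      using nonneg by (force simp: not_less)
    with unb bounded_subset[OF bounded_closed_interval] show False by blast
  qed
  obtain x1 where x1: "x1 > B" "pa x1 > 0" using beyond[OF B] by blast
  have comb: "pa x1 powr (1 - u) * pa z powr u \<le> pa y"
    if "x1 < y" "y < z" "u = (y - x1) / (z - x1)" for y z u
  proof -
    have u: "u \<in> {0<..<1}" unfolding that(3) using that(1,2) by (auto simp: pos_divide_less_eq)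
    have "u * (z - x1) = y - x1" using that by simp
    then have "(1 - u) * x1 + u * z = y" by (simp add: algebra_simps)
    then show ?thesis using lc u x1 that unfolding log_concave_on_def
      by (metis greaterThan_iff less_trans)
  qed
  have pos: "pa y > 0" if "y > x1" for y
  proof -
    have "y > 0" using that x1 B by linarith
    then obtain z where z: "z > y" "pa z > 0" using beyond by blast
    have "0 < pa x1 powr (1 - (y - x1) / (z - x1)) * pa z powr ((y - x1) / (z - x1))"
      using x1 z by simp
    with comb[OF that z(1) refl] show ?thesis by linarith
  qed
  \<comment> \<open>If \<open>- ln (pa y) > K' * y\<close> and \<open>y \<ge> 1\<close>, the chord of \<open>- ln pa\<close> from \<open>x1\<close> to \<open>y\<close> has slope at least \<open>K\<close>.\<close>
  define K' where "K' = K + \<bar>ln (pa x1)\<bar>"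
  have "\<forall>\<^sub>F \<alpha> in at_top. neg_log_density pa \<alpha> / ereal \<alpha> > ereal K'"
    using lim by (rule order_tendstoD(1)) simp
  then obtain A where A: "\<And>\<alpha>. \<alpha> \<ge> A \<Longrightarrow> neg_log_density pa \<alpha> / ereal \<alpha> > ereal K'"
    by (auto simp: eventually_at_top_linorder)
  define y0 where "y0 = max A (max 1 (x1 + 1))"
  have chord: "ln (pa y) \<le> ln (pa x1) - K * (y - x1)" if "y \<ge> y0" for y
  proof -
    have y: "y \<ge> A" "y \<ge> 1" "y > x1" using that by (auto simp: y0_def)
    from A[OF y(1)] pos[OF y(3)] y have "K' < - ln (pa y) / y" by (simp add: neg_log_density_def)
    moreover have "y > 0" using y by linarith
    ultimately have "K' * y < - ln (pa y)" by (simp only: pos_less_divide_eq)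
    moreover have "\<bar>ln (pa x1)\<bar> * 1 \<le> \<bar>ln (pa x1)\<bar> * y" using y by (intro mult_left_mono) auto
    moreover have "K * x1 \<ge> 0" using K x1 B by simp
    ultimately show ?thesis by (simp add: K'_def algebra_simps abs_le_iff)
  qed
  have "pa (y + s) \<le> pa y * exp (- K * s)" if y: "y \<ge> y0" and s: "s \<ge> 0" for y s
  proof (cases "s = 0")
    case False
    with s have s: "s > 0" by simp
    have yx: "y > x1" using y by (auto simp: y0_def)
    define z where "z = y + s"
    define u where "u = (y - x1) / (z - x1)"
    have u: "u > 0" "1 - u = s / (z - x1)" using yx s by (auto simp: u_def z_def field_simps)
    have "ln (pa x1 powr (1 - u) * pa z powr u) \<le> ln (pa y)"
      using comb[OF yx, of z u] s x1 pos[of z] pos[of y] yx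
      by (subst ln_le_cancel_iff) (auto simp: z_def u_def)
    then have "(1 - u) * ln (pa x1) + u * ln (pa z) \<le> ln (pa y)"
      using x1 pos[of z] yx s by (simp add: ln_mult z_def)
    moreover have "(1 - u) * (ln (pa y) + K * (y - x1)) \<le> (1 - u) * ln (pa x1)"
      using chord[OF y] u s yx by (intro mult_left_mono) (auto simp: z_def)
    moreover have "(1 - u) * (K * (y - x1)) = u * (K * s)"
      unfolding u(2) by (simp add: u_def)
    ultimately have "u * ln (pa z) \<le> u * (ln (pa y) - K * s)" by (simp add: algebra_simps)
    then have "ln (pa z) \<le> ln (pa y) - K * s" using u by simp
    then have "exp (ln (pa z)) \<le> exp (ln (pa y)) * exp (- K * s)"
      by (simp add: exp_add[symmetric])
    then show ?thesis using pos[of z] pos[of y] yx s by (simp add: z_def)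
  qed simp
  then show ?thesis
    using pos by (intro exI[of _ y0] conjI allI impI) (auto simp: y0_def)
qed

context prior_density
begin

text \<open>
  Let \<open>x = \<delta> * N\<close>.  Beyond \<open>x\<close> the prior mass is at most \<open>pa (x / 2) * exp (- K * x / 2) / K\<close>, whereas
  on \<open>[x / 4, x / 2]\<close> the density is at least \<open>pa (x / 2)\<close>.  The likelihood on that interval costs the
  factor \<open>exp (- N * distinct_rate (\<delta> / 4))\<close>, which is beaten by taking \<open>K\<close> large.
\<close>

lemma light_tail_concentrates:
  assumes "light_tail pa"
  shows "prior_weight_concentrates pa 0"
  unfolding prior_weight_concentrates_def
proof (intro allI impI)
  fix \<delta> :: real assume \<delta>: "\<delta> > 0"
  have region: "\<alpha> \<ge> \<delta> * real N" if "\<alpha> > 0" "\<bar>\<alpha> / (\<alpha> + real N) - 0\<bar> \<ge> \<delta>" for \<alpha> N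
  proof -
    have "\<delta> * (\<alpha> + real N) \<le> \<alpha>" using that by (simp add: pos_le_divide_eq)
    moreover have "\<delta> * real N \<le> \<delta> * (\<alpha> + real N)" using that \<delta> by (intro mult_left_mono) auto
    ultimately show ?thesis by linarith
  qed
  show "(\<lambda>N. joint_mass pa N {\<alpha>. \<bar>\<alpha> / (\<alpha> + real N) - 0\<bar> \<ge> \<delta>} / joint_mass pa N UNIV) \<longlonglongrightarrow> 0"
  proof (cases "bounded {\<alpha>. \<alpha> > 0 \<and> pa \<alpha> \<noteq> 0}")
    case True
    then obtain R where R: "\<And>\<alpha>. \<alpha> > 0 \<Longrightarrow> pa \<alpha> \<noteq> 0 \<Longrightarrow> \<alpha> \<le> R"
      unfolding bounded_pos by force
    have "\<forall>\<^sub>F N in sequentially. R / \<delta> < real N"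
      by (rule eventually_gt_at_top[THEN filterlim_real_sequentially[unfolded filterlim_iff, rule_format]])
    then have "\<forall>\<^sub>F N in sequentially.
        joint_mass pa N {\<alpha>. \<bar>\<alpha> / (\<alpha> + real N) - 0\<bar> \<ge> \<delta>} / joint_mass pa N UNIV = 0"
    proof eventually_elim
      case (elim N)
      then have "R < \<delta> * real N" using \<delta> by (simp add: pos_divide_less_eq mult.commute)
      with region R have "pa \<alpha> = 0" if "\<alpha> > 0" "\<bar>\<alpha> / (\<alpha> + real N) - 0\<bar> \<ge> \<delta>" for \<alpha>
        using that by (meson less_le_trans not_less)
      then have "joint_mass pa N {\<alpha>. \<bar>\<alpha> / (\<alpha> + real N) - 0\<bar> \<ge> \<delta>} = (\<integral>\<^sup>+\<alpha>. 0 \<partial>(lborel :: real measure))"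
        unfolding joint_mass_def by (intro nn_integral_cong) (auto simp: indicator_def)
      then show ?case by simp
    qed
    then show ?thesis by (rule tendsto_eventually)
  next
    case False
    with assms obtain B where B: "B > 0" "log_concave_on {B<..} pa"
      and lim: "((\<lambda>\<alpha>. neg_log_density pa \<alpha> / ereal \<alpha>) \<longlongrightarrow> \<infinity>) at_top"
      by (auto simp: light_tail_def)
    \<comment> \<open>This choice leaves a net decay \<open>exp (- N)\<close> after paying for the likelihood.\<close>
    define K where "K = 2 / \<delta> * (\<bar>distinct_rate (\<delta> / 4)\<bar> + 1)"
    have K: "K > 0" using \<delta> by (simp add: K_def)
    have K\<delta>: "K * \<delta> / 2 = \<bar>distinct_rate (\<delta> / 4)\<bar> + 1" using \<delta> by (simp add: K_def)
    obtain y0 where y0: "y0 > 0" "\<And>y. y \<ge> y0 \<Longrightarrow> pa y > 0"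
      "\<And>y s. y \<ge> y0 \<Longrightarrow> s \<ge> 0 \<Longrightarrow> pa (y + s) \<le> pa y * exp (- K * s)"
      using log_concave_superlinear_decay[OF B(2,1) pa_nonneg False lim K] by blast
    define x where "x N = \<delta> * real N" for N :: nat
    define a where "a N = pa (x N / 2) * exp (- K * (x N / 2)) / K" for N
    define b where "b N = (x N / 2 - x N / 4) * pa (x N / 2) * exp (- (real N * distinct_rate (\<delta> / 4)))" for N
    show ?thesis
    proof (rule tendsto_0_of_ratio_bound)
      show "(\<lambda>N. 4 / (K * \<delta>) * exp (- (1 * real N))) \<longlonglongrightarrow> 0"
        by (rule exp_neg_mult_tendsto_0) simp
      have "\<forall>\<^sub>F N in sequentially. 4 * y0 / \<delta> \<le> real N"
        by (rule eventually_ge_at_top[THEN filterlim_real_sequentially[unfolded filterlim_iff, rule_format]])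
      with eventually_gt_at_top[of 0]
      show "\<forall>\<^sub>F N in sequentially.
          joint_mass pa N {\<alpha>. \<bar>\<alpha> / (\<alpha> + real N) - 0\<bar> \<ge> \<delta>} \<le> ennreal (a N) \<and>
          ennreal (b N) \<le> joint_mass pa N UNIV \<and> b N > 0 \<and> a N \<ge> 0 \<and>
          a N / b N \<le> 4 / (K * \<delta>) * exp (- (1 * real N))"
      proof eventually_elim
        case (elim N)
        have xN: "x N > 0" "x N / 4 \<ge> y0" using elim \<delta> by (auto simp: x_def field_simps)
        define p where "p = pa (x N / 2)"
        have p: "p > 0" using y0(2)[of "x N / 2"] xN by (simp add: p_def)
        have "joint_mass pa N {\<alpha>. \<bar>\<alpha> / (\<alpha> + real N) - 0\<bar> \<ge> \<delta>} \<le> joint_mass pa N {x N..}"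
          by (rule joint_mass_mono) (use region in \<open>auto simp: x_def\<close>)
        also have "\<dots> \<le> (\<integral>\<^sup>+\<alpha>. ennreal (p * exp (K * (x N / 2))) * (ennreal (exp (- K * \<alpha>)) * indicator {x N..} \<alpha>) \<partial>lborel)"
          unfolding joint_mass_def
        proof (intro nn_integral_mono)
          fix \<alpha>
          show "ennreal (pa \<alpha> * all_distinct_prob N \<alpha>) * indicator ({0<..} \<inter> {x N..}) \<alpha>
            \<le> ennreal (p * exp (K * (x N / 2))) * (ennreal (exp (- K * \<alpha>)) * indicator {x N..} \<alpha>)"
          proof (cases "\<alpha> \<ge> x N")
            case True
            then have \<alpha>: "\<alpha> > 0" using xN by simp
            have "pa \<alpha> * all_distinct_prob N \<alpha> \<le> pa \<alpha> * 1"
              using \<alpha> pa_nonneg all_distinct_prob_le_1 by (intro mult_left_mono) auto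
            also have "\<dots> \<le> p * exp (- K * (\<alpha> - x N / 2))"
              using y0(3)[of "x N / 2" "\<alpha> - x N / 2"] True xN by (simp add: p_def)
            also have "- K * (\<alpha> - x N / 2) = K * (x N / 2) + - K * \<alpha>" by (simp add: algebra_simps)
            also have "p * exp \<dots> = p * exp (K * (x N / 2)) * exp (- K * \<alpha>)"
              by (simp only: exp_add mult.assoc)
            finally show ?thesis
              using True \<alpha> p by (simp add: ennreal_mult[symmetric] ennreal_leI)
          qed (auto simp: indicator_def)
        qed
        also have "\<dots> = ennreal (p * exp (K * (x N / 2))) * ennreal (exp (- K * x N) / K)"
          by (subst nn_integral_cmult) (use K in \<open>simp_all only: nn_integral_exp_tail, measurable\<close>)
        also have "\<dots> = ennreal (p * exp (K * (x N / 2)) * (exp (- K * x N) / K))"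
          using p K by (simp add: ennreal_mult[symmetric])
        also have "p * exp (K * (x N / 2)) * (exp (- K * x N) / K) = a N"
        proof -
          have "exp (K * (x N / 2)) * exp (- K * x N) = exp (- K * (x N / 2))"
            by (simp add: exp_add[symmetric])
          then show ?thesis by (simp add: a_def p_def)
        qed
        finally have 1: "joint_mass pa N {\<alpha>. \<bar>\<alpha> / (\<alpha> + real N) - 0\<bar> \<ge> \<delta>} \<le> ennreal (a N)" .
        have "b N \<le> (x N / 2 - x N / 4) * p * all_distinct_prob N (x N / 4)"
          unfolding b_def p_def[symmetric]
          using all_distinct_prob_bounds(1)[of "\<delta> / 4" N] \<delta> elim(1) xN p
          by (intro mult_left_mono) (auto simp: x_def)
        also have "ennreal \<dots> \<le> joint_mass pa N UNIV"
        proof (rule joint_mass_ge_interval)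
          fix \<alpha> assume \<alpha>: "x N / 4 \<le> \<alpha>" "\<alpha> \<le> x N / 2"
          have "p \<le> pa \<alpha> * exp (- K * (x N / 2 - \<alpha>))"
            using y0(3)[of \<alpha> "x N / 2 - \<alpha>"] \<alpha> xN by (simp add: p_def)
          also have "\<dots> \<le> pa \<alpha> * 1"
            using y0(2)[of \<alpha>] \<alpha> xN K by (intro mult_left_mono) (auto simp: mult_le_0_iff)
          finally show "p \<le> pa \<alpha>" by simp
        qed (use xN p in auto)
        finally have 2: "ennreal (b N) \<le> joint_mass pa N UNIV" by (simp add: ennreal_leI)
        have "a N / b N = 4 / (K * x N) * exp (- K * (x N / 2) - - (real N * distinct_rate (\<delta> / 4)))"
          using p xN unfolding a_def b_def p_def[symmetric] exp_diff by (simp add: field_simps)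
        also have "- K * (x N / 2) - - (real N * distinct_rate (\<delta> / 4))
            = - (K * \<delta> / 2 - distinct_rate (\<delta> / 4)) * real N"
          by (simp add: x_def algebra_simps)
        also have "4 / (K * x N) * exp \<dots> \<le> 4 / (K * \<delta>) * exp (- (1 * real N))"
        proof (intro mult_mono)
          have "K * \<delta> * 1 \<le> K * \<delta> * real N" using K \<delta> elim by (intro mult_left_mono) auto
          then show "4 / (K * x N) \<le> 4 / (K * \<delta>)"
            using K \<delta> by (intro divide_left_mono) (auto simp: x_def mult.assoc elim)
          have "1 * real N \<le> (K * \<delta> / 2 - distinct_rate (\<delta> / 4)) * real N"
            unfolding K\<delta> by (intro mult_right_mono) auto
          then show "exp (- (K * \<delta> / 2 - distinct_rate (\<delta> / 4)) * real N) \<le> exp (- (1 * real N))"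
            unfolding mult_minus_left exp_le_cancel_iff by linarith
        qed (use K \<delta> in auto)
        finally have 3: "a N / b N \<le> 4 / (K * \<delta>) * exp (- (1 * real N))" .
        have "a N \<ge> 0" "b N > 0"
          using p K xN unfolding a_def b_def p_def[symmetric] by auto
        with 1 2 3 show ?case by blast
      qed
    qed
  qed
qed

end

section \<open>Posterior consistency\<close>

text \<open>
  For a sample without ties, the number \<open>k\<close> of distinct values in the posterior kernel is \<open>N\<close>.
\<close>

lemma (in prior_density) alpha_posterior_density_distinct:
  assumes y: "inj y" and \<alpha>: "\<alpha> > 0"
  shows "alpha_posterior_density pa N y \<alpha>
    = ennreal (pa \<alpha> * all_distinct_prob N \<alpha>) / joint_mass pa N UNIV"
proof -
  have card: "card (y ` {..<N}) = N"
    using y by (subst card_image) (auto intro: inj_on_subset)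
  have kernel: "alpha_posterior_kernel pa N y \<beta> = ennreal (pa \<beta> * all_distinct_prob N \<beta>)" if "\<beta> > 0" for \<beta>
    using all_distinct_prob_Gamma[OF that, of N]
    by (simp add: alpha_posterior_kernel_def card mult.assoc flip: times_divide_eq_right)
  have "(\<integral>\<^sup>+\<beta>\<in>{0<..}. alpha_posterior_kernel pa N y \<beta> \<partial>lborel) = joint_mass pa N UNIV"
    unfolding joint_mass_def by (intro nn_integral_cong) (auto simp: kernel indicator_def)
  then show ?thesis by (simp add: alpha_posterior_density_def kernel[OF \<alpha>])
qed

lemma ennreal_self_divide_le_1: "(x::ennreal) / x \<le> 1"
  by (cases "x = 0"; cases "x = top") (auto simp: less_top)

text \<open>
  The posterior integral is split according to whether \<open>\<alpha> \<in> S\<close>.  A nonnegative integral is monotone for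
  arbitrary integrands, so a bound that is pointwise in \<open>\<alpha>\<close> suffices.
\<close>

lemma (in prior_density) posterior_prob_le:
  assumes y: "inj y" and S: "S \<in> sets borel" and c: "c \<ge> 0"
    and DP: "\<And>\<alpha>. \<alpha> > 0 \<Longrightarrow> emeasure (dirichlet_process (\<alpha> + real N)
          (mixture (\<alpha> / (\<alpha> + real N)) H (empirical_measure N y))) B \<le> ennreal c + indicator S \<alpha>"
  shows "posterior_prob pa H N y B \<le> ennreal c + joint_mass pa N S / joint_mass pa N UNIV"
proof -
  define Z where "Z = joint_mass pa N UNIV"
  note S [measurable]
  have "posterior_prob pa H N y B \<le>
      (\<integral>\<^sup>+\<alpha>. ennreal c * ((ennreal (pa \<alpha> * all_distinct_prob N \<alpha>) * indicator ({0<..} \<inter> UNIV) \<alpha>) / Z)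
        + (ennreal (pa \<alpha> * all_distinct_prob N \<alpha>) * indicator ({0<..} \<inter> S) \<alpha>) / Z \<partial>lborel)"
    unfolding posterior_prob_def
  proof (intro nn_integral_mono)
    fix \<alpha>
    show "emeasure (dirichlet_process (\<alpha> + real N)
          (mixture (\<alpha> / (\<alpha> + real N)) H (empirical_measure N y))) B
        * alpha_posterior_density pa N y \<alpha> * indicator {0<..} \<alpha>
      \<le> ennreal c * ((ennreal (pa \<alpha> * all_distinct_prob N \<alpha>) * indicator ({0<..} \<inter> UNIV) \<alpha>) / Z)
        + (ennreal (pa \<alpha> * all_distinct_prob N \<alpha>) * indicator ({0<..} \<inter> S) \<alpha>) / Z"
    proof (cases "\<alpha> > 0")
      case True
      have "emeasure (dirichlet_process (\<alpha> + real N)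
          (mixture (\<alpha> / (\<alpha> + real N)) H (empirical_measure N y))) B * alpha_posterior_density pa N y \<alpha>
        \<le> (ennreal c + indicator S \<alpha>) * alpha_posterior_density pa N y \<alpha>"
        by (intro mult_right_mono DP True) simp
      also have "\<dots> = ennreal c * (ennreal (pa \<alpha> * all_distinct_prob N \<alpha>) / Z)
          + ennreal (pa \<alpha> * all_distinct_prob N \<alpha>) * indicator S \<alpha> / Z"
        unfolding alpha_posterior_density_distinct[OF y True] Z_def
        by (simp add: distrib_right indicator_def)
      finally show ?thesis using True by (simp add: indicator_def)
    qed (simp add: indicator_def)
  qed
  also have "\<dots> = ennreal c * (joint_mass pa N UNIV / Z) + joint_mass pa N S / Z"
    unfolding joint_mass_def
    by (subst nn_integral_add, measurable) (simp add: nn_integral_cmult nn_integral_divide)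
  also have "\<dots> \<le> ennreal c * 1 + joint_mass pa N S / Z"
    unfolding Z_def by (intro add_mono mult_left_mono ennreal_self_divide_le_1) auto
  finally show ?thesis by (simp add: Z_def)
qed

lemma mixture_prob:
  assumes P: "prob_space P" and Q: "prob_space Q" and sets: "sets Q = sets P" and u: "0 \<le> u" "u \<le> 1"
  shows "prob_space (mixture u P Q)"
    and "A \<in> sets P \<Longrightarrow> measure (mixture u P Q) A = u * measure P A + (1 - u) * measure Q A"
proof -
  interpret P: prob_space P by fact
  interpret Q: prob_space Q by fact
  have em: "emeasure (mixture u P Q) A = ennreal (u * measure P A + (1 - u) * measure Q A)" if "A \<in> sets P" for A
    using emeasure_mixture[OF sets that, of u] u
    by (simp add: P.emeasure_eq_measure Q.emeasure_eq_measure ennreal_mult[symmetric] ennreal_plus[symmetric]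
        del: ennreal_plus)
  have sp: "space (mixture u P Q) = space P" by (intro sets_eq_imp_space_eq) simp
  have "space Q = space P" using sets by (rule sets_eq_imp_space_eq)
  then have "emeasure (mixture u P Q) (space (mixture u P Q)) = 1"
    unfolding sp using em[of "space P"] P.prob_space Q.prob_space by simp
  then show "prob_space (mixture u P Q)" by (rule prob_spaceI)
  show "measure (mixture u P Q) A = u * measure P A + (1 - u) * measure Q A" if "A \<in> sets P"
    by (rule measure_eq_emeasure_eq_ennreal[OF _ em[OF that]]) (use u in auto)
qed

lemma mixture_difference:
  fixes u v hA eA pA :: real
  assumes "0 \<le> hA" "hA \<le> 1" "0 \<le> eA" "eA \<le> 1" "0 \<le> v" "v \<le> 1"
  shows "\<bar>(u * hA + (1 - u) * eA) - (v * hA + (1 - v) * pA)\<bar> \<le> \<bar>u - v\<bar> + \<bar>eA - pA\<bar>"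
proof -
  have "(u * hA + (1 - u) * eA) - (v * hA + (1 - v) * pA) = (u - v) * (hA - eA) + (1 - v) * (eA - pA)"
    by (simp add: algebra_simps)
  also have "\<bar>\<dots>\<bar> \<le> \<bar>u - v\<bar> * \<bar>hA - eA\<bar> + (1 - v) * \<bar>eA - pA\<bar>"
    using assms(5,6) by (intro order.trans[OF abs_triangle_ineq]) (simp add: abs_mult)
  also have "\<dots> \<le> \<bar>u - v\<bar> * 1 + 1 * \<bar>eA - pA\<bar>"
    using assms by (intro add_mono mult_left_mono mult_right_mono) auto
  finally show ?thesis by simp
qed

text \<open>
  The deterministic core: for a fixed sequence of observations without ties whose frequencies converge on
  the finite unions of basic sets, concentration of the weight of \<open>H\<close> at \<open>v\<close> yields consistency at
  \<open>v H + (1 - v) P0\<close>.  If the weight is within \<open>\<eta> / 4\<close> of \<open>v\<close>, the masses of finitely many control sets under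
  the base distribution are eventually within \<open>\<eta> / 2\<close> of their limits, and those under the random
  distribution within \<open>\<eta> / 2\<close> of those under the base distribution except with probability \<open>O(1 / N)\<close>.
\<close>

lemma (in prior_density) posterior_consistent:
  fixes H P0 :: "'a::second_countable_topology measure"
  assumes H: "prob_space H" "sets H = sets borel" and P0: "prob_space P0" "sets P0 = sets borel"
    and \<rho>: "metrizes_convergence_in_distribution \<rho>"
    and v: "0 \<le> v" "v \<le> 1" and conc: "prior_weight_concentrates pa v"
    and B: "topological_basis B" "countable B" and y: "inj y"
    and freq: "\<And>S. finite S \<Longrightarrow> S \<subseteq> B \<Longrightarrow>
      (\<lambda>N. measure (empirical_measure N y) (\<Union>S)) \<longlonglongrightarrow> measure P0 (\<Union>S)"
    and \<epsilon>: "\<epsilon> > 0"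
    and Q: "prob_space Q" "sets Q = sets borel"
      "\<And>A. A \<in> sets borel \<Longrightarrow> measure Q A = v * measure H A + (1 - v) * measure P0 A"
  shows "(\<lambda>N. posterior_prob pa H N y {P \<in> space (prob_algebra borel). \<rho> P Q > \<epsilon>}) \<longlonglongrightarrow> 0"
proof -
  define Bad where "Bad = {P \<in> space (prob_algebra borel). \<rho> P Q > \<epsilon>}"
  have "Q \<in> space (prob_algebra borel)" using Q by (simp add: space_prob_algebra_borel)
  from finitely_many_sets_control_metric[OF \<rho> B this \<epsilon>, folded Bad_def]
  obtain F \<eta> where F: "finite F" "\<forall>A\<in>F. \<exists>S. finite S \<and> S \<subseteq> B \<and> A = \<Union>S" and \<eta>: "\<eta> > 0"
    and Bad: "Bad \<subseteq> (\<Union>A\<in>F. {P \<in> space (prob_algebra borel). \<bar>measure P A - measure Q A\<bar> > \<eta>})"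
    by (elim exE conjE) (rule that; assumption)
  have F_borel: "F \<subseteq> sets borel"
  proof
    fix A assume "A \<in> F"
    from bspec[OF F(2) this] obtain S where S: "S \<subseteq> B" "A = \<Union>S" by (elim exE conjE)
    have "open A"
      unfolding S(2) using topological_basis_open[OF B(1)] S(1) by (intro open_Union) blast
    then show "A \<in> sets borel" by simp
  qed
  \<comment> \<open>Deviations up to \<open>2 * r\<close> are controlled, and only for \<open>r \<le> 1 / 4\<close>.\<close>
  define r where "r = min (\<eta> / 4) (1 / 4)"
  have r: "0 < r" "r \<le> 1 / 4" "2 * r \<le> \<eta> / 2" using \<eta> by (auto simp: r_def)
  define S where "S N = {\<alpha>. \<bar>\<alpha> / (\<alpha> + real N) - v\<bar> \<ge> \<eta> / 4}" for N :: nat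
  have S_meas: "S N \<in> sets borel" for N unfolding S_def by measurable
  have "\<forall>\<^sub>F N in sequentially. \<forall>A\<in>F. \<bar>measure (empirical_measure N y) A - measure P0 A\<bar> < \<eta> / 4"
  proof (intro eventually_ball_finite F(1) ballI)
    fix A assume "A \<in> F"
    from bspec[OF F(2) this] obtain S where "finite S" "S \<subseteq> B" "A = \<Union>S" by (elim exE conjE)
    with freq have "(\<lambda>N. measure (empirical_measure N y) A) \<longlonglongrightarrow> measure P0 A" by simp
    from tendstoD[OF this, of "\<eta> / 4"] \<eta>
    show "\<forall>\<^sub>F N in sequentially. \<bar>measure (empirical_measure N y) A - measure P0 A\<bar> < \<eta> / 4"
      by (simp add: dist_real_def)
  qed
  with eventually_gt_at_top[of 0]
  have bound: "\<forall>\<^sub>F N in sequentially. posterior_prob pa H N y Bad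
      \<le> ennreal (real (card F) / r\<^sup>2 * (1 / real N)) + joint_mass pa N (S N) / joint_mass pa N UNIV"
  proof eventually_elim
    case (elim N)
    show ?case
    proof (rule posterior_prob_le[OF y S_meas])
      fix \<alpha> :: real assume \<alpha>: "\<alpha> > 0"
      define E where "E = empirical_measure N y"
      define u where "u = \<alpha> / (\<alpha> + real N)"
      define G where "G = mixture u H E"
      have u: "0 \<le> u" "u \<le> 1" using \<alpha> by (auto simp: u_def)
      have E: "prob_space E" "sets E = sets H"
        using prob_space_empirical_measure[OF elim(1)] H by (auto simp: E_def)
      have G: "prob_space G" "sets G = sets borel"
        unfolding G_def using mixture_prob(1)[OF H(1) E u] H by auto
      show "emeasure (dirichlet_process (\<alpha> + real N) G) Bad
          \<le> ennreal (real (card F) / r\<^sup>2 * (1 / real N)) + indicator (S N) \<alpha>"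
      proof (cases "\<alpha> \<in> S N")
        case True
        have "emeasure (dirichlet_process (\<alpha> + real N) G) Bad \<le> 1" by (rule emeasure_dirichlet_process_le_1)
        with True show ?thesis by (simp add: add_increasing)
      next
        case False
        have close: "\<bar>measure G A - measure Q A\<bar> < \<eta> / 2" if A: "A \<in> F" for A
        proof -
          interpret H: prob_space H by fact
          interpret E: prob_space E by fact
          have Ab: "A \<in> sets borel" using A F_borel by auto
          have "A \<in> sets H" using Ab H(2) by simp
          then have "measure G A = u * measure H A + (1 - u) * measure E A"
            unfolding G_def by (rule mixture_prob(2)[OF H(1) E u])
          then have "\<bar>measure G A - measure Q A\<bar> \<le> \<bar>u - v\<bar> + \<bar>measure E A - measure P0 A\<bar>"
            unfolding Q(3)[OF Ab] using v
            by (simp only:) (intro mixture_difference; simp)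
          also have "\<bar>u - v\<bar> < \<eta> / 4" using False by (simp add: S_def u_def)
          also have "\<bar>measure E A - measure P0 A\<bar> < \<eta> / 4" using elim A by (simp add: E_def)
          finally show ?thesis by simp
        qed
        have "Bad \<subseteq> (\<Union>A\<in>F. {P \<in> space (prob_algebra borel). \<bar>measure P A - measure G A\<bar> > 2 * r})"
        proof
          fix P assume "P \<in> Bad"
          from subsetD[OF Bad this]
          obtain A where A: "A \<in> F" "P \<in> space (prob_algebra borel)" "\<bar>measure P A - measure Q A\<bar> > \<eta>"
            by (elim UN_E CollectE conjE)
          with close[OF A(1)] r(3) have "\<bar>measure P A - measure G A\<bar> > 2 * r" by linarith
          with A(1,2) show "P \<in> (\<Union>A\<in>F. {P \<in> space (prob_algebra borel). \<bar>measure P A - measure G A\<bar> > 2 * r})"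
            by (intro UN_I CollectI conjI)
        qed
        then have "emeasure (dirichlet_process (\<alpha> + real N) G) Bad
            \<le> ennreal (real (card F) / (r\<^sup>2 * (\<alpha> + real N)))"
          using \<alpha> by (intro emeasure_dirichlet_process_le[OF G _ r(1,2) F(1) F_borel]) simp_all
        also have "\<dots> \<le> ennreal (real (card F) / (r\<^sup>2 * real N))"
          using \<alpha> elim r by (intro ennreal_leI divide_left_mono mult_left_mono) auto
        finally show ?thesis using False by simp
      qed
    qed simp
  qed
  have "(\<lambda>N. ennreal (real (card F) / r\<^sup>2 * (1 / real N)) + joint_mass pa N (S N) / joint_mass pa N UNIV)
      \<longlonglongrightarrow> ennreal (real (card F) / r\<^sup>2 * 0) + 0"
  proof (rule tendsto_add)
    show "(\<lambda>N. ennreal (real (card F) / r\<^sup>2 * (1 / real N))) \<longlonglongrightarrow> ennreal (real (card F) / r\<^sup>2 * 0)"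
      by (intro tendsto_ennrealI tendsto_mult_left lim_1_over_n)
    show "(\<lambda>N. joint_mass pa N (S N) / joint_mass pa N UNIV) \<longlonglongrightarrow> 0"
      unfolding S_def
      by (rule conc[unfolded prior_weight_concentrates_def, rule_format]) (use \<eta> in simp)
  qed
  then have lim: "(\<lambda>N. ennreal (real (card F) / r\<^sup>2 * (1 / real N)) + joint_mass pa N (S N) / joint_mass pa N UNIV)
      \<longlonglongrightarrow> 0" by simp
  show ?thesis
    unfolding Bad_def[symmetric]
  proof (rule tendsto_sandwich[of "\<lambda>_. 0"])
    show "\<forall>\<^sub>F N in sequentially. posterior_prob pa H N y Bad
        \<le> ennreal (real (card F) / r\<^sup>2 * (1 / real N)) + joint_mass pa N (S N) / joint_mass pa N UNIV"
      by (rule bound)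
  qed (use lim in simp_all)
qed

text \<open>
  The three regimes differ only in the limiting weight \<open>v = t / (1 + t)\<close>.
\<close>

lemma tail_regime_limit:
  assumes "(light_tail pa \<and> t = 0) \<or> (\<exists>c. exponential_tail pa c \<and> t = ennreal (exponential_limit c)) \<or>
      (heavy_tail pa \<and> t = \<infinity>)"
    and pa: "prior_density pa"
    and H: "prob_space H" "sets H = sets borel" and P0: "prob_space P0" "sets P0 = sets borel"
  shows "\<exists>v. 0 \<le> v \<and> v \<le> 1 \<and> prior_weight_concentrates pa v \<and>
    prob_space (limit_dist H P0 t) \<and> sets (limit_dist H P0 t) = sets borel \<and>
    (\<forall>A\<in>sets borel. measure (limit_dist H P0 t) A = v * measure H A + (1 - v) * measure P0 A)"
proof -
  interpret prior_density pa by fact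
  have finite_case: ?thesis if s: "s \<ge> 0" "t = ennreal s" "prior_weight_concentrates pa (s / (1 + s))" for s
  proof -
    have lim: "limit_dist H P0 t = mixture (s / (1 + s)) H P0"
      using s by (simp add: limit_dist_def)
    show ?thesis
      unfolding lim using mixture_prob[OF H(1) P0(1), of "s / (1 + s)"] s H P0
      by (intro exI[of _ "s / (1 + s)"]) auto
  qed
  from assms(1) show ?thesis
  proof (elim disjE conjE exE)
    assume "light_tail pa" "t = 0"
    then show ?thesis using light_tail_concentrates by (intro finite_case[of 0]) auto
  next
    fix c assume c: "exponential_tail pa c" "t = ennreal (exponential_limit c)"
    then have "c > 0" by (simp add: exponential_tail_def)
    from theI'[OF rate_slope_bij[OF this]]
    have "exponential_limit c > 0" "rate_slope (exponential_limit c) = c"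
      unfolding exponential_limit_def rate_slope_def by auto
    then show ?thesis
      using c exponential_tail_concentrates[OF c(1)] by (intro finite_case[of "exponential_limit c"]) auto
  next
    assume "heavy_tail pa" "t = \<infinity>"
    then show ?thesis using heavy_tail_concentrates H by (intro exI[of _ 1]) (auto simp: limit_dist_def)
  qed
qed

theorem theorem1:
  fixes P0 H :: "'a::euclidean_space measure"
    and p0 h :: "'a \<Rightarrow> real"
    and pa :: "real \<Rightarrow> real"
    and M :: "'w measure"
    and Y :: "nat \<Rightarrow> 'w \<Rightarrow> 'a"
    and \<rho> :: "'a measure \<Rightarrow> 'a measure \<Rightarrow> real"
  assumes p0: "p0 \<in> borel_measurable borel" "\<And>y. 0 \<le> p0 y"
    and P0: "prob_space P0" "P0 = density lborel (\<lambda>y. ennreal (p0 y))"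
    and h: "h \<in> borel_measurable borel" "\<And>y. 0 \<le> h y"
    and H: "prob_space H" "H = density lborel (\<lambda>y. ennreal (h y))"
    and H_neq_P0: "H \<noteq> P0"
    and P0_support: "measure P0 {y. h y > 0} = 1"
    and pa: "pa \<in> borel_measurable borel" "\<And>\<alpha>. \<alpha> > 0 \<Longrightarrow> 0 \<le> pa \<alpha>"
      "(\<integral>\<^sup>+\<alpha>\<in>{0<..}. ennreal (pa \<alpha>) \<partial>lborel) = 1"
    and M: "prob_space M"
    and Y_indep: "prob_space.indep_vars M (\<lambda>_. borel) Y UNIV"
    and Y_distr: "\<And>i. distr M borel (Y i) = P0"
    and \<rho>: "metrizes_convergence_in_distribution \<rho>"
  shows "(\<forall>c>0. \<exists>!t::real. t > 0 \<and> 1 / t - ln (1 + 1 / t) = c) \<and>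
    (\<forall>t. (light_tail pa \<and> t = 0) \<or>
         (\<exists>c. exponential_tail pa c \<and> t = ennreal (exponential_limit c)) \<or>
         (heavy_tail pa \<and> t = \<infinity>) \<longrightarrow>
       (\<forall>\<epsilon>>0. AE \<omega> in M.
          (\<lambda>N. posterior_prob pa H N (\<lambda>i. Y i \<omega>)
                 {P \<in> space (prob_algebra borel). \<rho> P (limit_dist H P0 t) > \<epsilon>}) \<longlonglongrightarrow> 0))"
proof (intro conjI allI impI)
  fix c :: real assume "c > 0"
  from rate_slope_bij[OF this] show "\<exists>!t::real. t > 0 \<and> 1 / t - ln (1 + 1 / t) = c"
    unfolding rate_slope_def .
next
  fix t and \<epsilon> :: real
  assume t: "(light_tail pa \<and> t = 0) \<or> (\<exists>c. exponential_tail pa c \<and> t = ennreal (exponential_limit c)) \<or>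
      (heavy_tail pa \<and> t = \<infinity>)" and \<epsilon>: "\<epsilon> > 0"
  interpret prior_density pa using pa by unfold_locales
  have setsH: "sets H = sets borel" and setsP0: "sets P0 = sets borel" by (simp_all add: H(2) P0(2))
  obtain v where v: "0 \<le> v" "v \<le> 1" "prior_weight_concentrates pa v"
    and Q: "prob_space (limit_dist H P0 t)" "sets (limit_dist H P0 t) = sets borel"
      "\<forall>A\<in>sets borel. measure (limit_dist H P0 t) A = v * measure H A + (1 - v) * measure P0 A"
    using tail_regime_limit[OF t prior_density_axioms H(1) setsH P0(1) setsP0]
    by (elim exE conjE) (rule that; assumption)
  \<comment> \<open>Countability leaves a single null set for all frequencies.\<close>
  obtain B :: "'a set set" where B: "topological_basis B" "countable B"
    using ex_countable_basis by blast
  have no_atoms: "AE y in P0. y \<noteq> x" for x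
  proof -
    have "AE y in lborel. y \<noteq> x" by (rule AE_lborel_singleton)
    then have "AE y in lborel. 0 < ennreal (p0 y) \<longrightarrow> y \<noteq> x" by eventually_elim simp
    then show ?thesis unfolding P0(2) using p0(1) by (subst AE_density) auto
  qed
  have "AE \<omega> in M. \<forall>S\<in>{S. finite S \<and> S \<subseteq> B}.
      (\<lambda>N. measure (empirical_measure N (\<lambda>i. Y i \<omega>)) (\<Union>S)) \<longlonglongrightarrow> measure P0 (\<Union>S)"
  proof (rule AE_ball_countable')
    fix S assume "S \<in> {S. finite S \<and> S \<subseteq> B}"
    then have "open (\<Union>S)" using topological_basis_open[OF B(1)] by (intro open_Union) blast
    then show "AE \<omega> in M. (\<lambda>N. measure (empirical_measure N (\<lambda>i. Y i \<omega>)) (\<Union>S)) \<longlonglongrightarrow> measure P0 (\<Union>S)"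
      by (intro AE_empirical_measure_tendsto M Y_indep Y_distr) auto
  qed (use B(2) in \<open>auto intro!: countable_Collect_finite_subset\<close>)
  then show "AE \<omega> in M. (\<lambda>N. posterior_prob pa H N (\<lambda>i. Y i \<omega>)
      {P \<in> space (prob_algebra borel). \<rho> P (limit_dist H P0 t) > \<epsilon>}) \<longlonglongrightarrow> 0"
    using AE_all_distinct[OF M Y_indep Y_distr no_atoms]
  proof eventually_elim
    case (elim \<omega>)
    show ?case
      by (rule posterior_consistent[OF H(1) setsH P0(1) setsP0 \<rho> v B elim(2) _ \<epsilon> Q(1,2)])
         (use elim(1) Q(3) in simp_all)
  qed
qed

end
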